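(* Let $q$ be a power of a prime $p$, let $C$ be the completion of an algebraic closure of $\mathbb{F}_q((1/\theta))$, let $t$ be an indeterminate and $\mathcal{K}=C(t)$, endowed with an absolute value $|\cdot|$ associated with the $t$-adic valuation. Let $\mathbb{K}$ be the completion of an algebraic closure of the $t$-adic completion of $\mathcal{K}$, identified (via a Kedlaya embedding) with a subfield of the field $C\langle\langle t\rangle\rangle$ of Hahn series $\sum_{i\in S}c_it^i$ ($c_i\in C$, $S\subset\mathbb{Q}$ well ordered), so that $|\sum_{i\in S}c_it^i|=c^{-\min S}$ for some real $c>1$. Let $\tau$ be the map $\sum_i c_it^i\mapsto\sum_i c_i^qt^i$ (it preserves $\mathbb{K}$ and $\mathcal{K}$), extended to $\mathbb{K}[[x]]$ by $\tau\bigl(\sum_i c_ix^i\bigr)=\sum_i(\tau c_i)x^{qi}$ and to $\mathcal{K}(x)$ as the field endomorphism acting by $\tau$ on $\mathcal{K}$ and sending $x$ to $x^q$. Let $f\in\mathcal{K}[[x]]$ converge for all $x\in\mathbb{K}$ with $|x|<1$, and let $\alpha\in\mathcal{K}$ with $0<|\alpha|<1$. Assume that $f$ is transcendental over $\mathcal{K}(x)$ and that $\tau f=af+b$ for some $a,b\in\mathcal{K}(x)$. Then, for all $n$ large enough, $(\tau^nf)(\alpha)$ is transcendental over $\mathcal{K}$. *)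

theory Defs
  imports "HOL-Analysis.Abstract_Metric_Spaces"
    "HOL-Computational_Algebra.Formal_Laurent_Series"
begin

section \<open>Hahn series with rational exponents\<close>

typedef (overloaded) 'a hahn = "{f :: rat \<Rightarrow> 'a::zero. wfp_on {i. f i \<noteq> 0} (<)}"
  morphisms hahn_nth Abs_hahn
  by (rule exI[of _ "\<lambda>_. 0"]) (simp add: wfp_on_def)

setup_lifting type_definition_hahn

definition hahn_supp :: "'a::zero hahn \<Rightarrow> rat set" where
  "hahn_supp x = {i. hahn_nth x i \<noteq> 0}"

lemma hahn_eqI: "(\<And>i. hahn_nth x i = hahn_nth y i) \<Longrightarrow> x = y"
  by (metis ext hahn_nth_inject)

lemma wfp_on_hahn_supp: "wfp_on (hahn_supp x) (<)"
  using hahn_nth[of x] by (simp add: hahn_supp_def)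

subsection \<open>Well-ordered sets of rationals\<close>

lemma wfp_on_Least:
  fixes A :: "rat set"
  assumes "wfp_on A (<)" "B \<subseteq> A" "B \<noteq> {}"
  shows "\<exists>m\<in>B. \<forall>y\<in>B. m \<le> y"
  using assms unfolding wfp_on_iff_ex_minimal by (meson not_le)

lemma wfp_on_no_descent:
  fixes A :: "rat set"
  assumes "wfp_on A (<)" "range s \<subseteq> A"
  shows "\<not> (\<forall>n. s (Suc n) < s n)"
proof -
  obtain m where "m \<in> range s" "\<forall>y\<in>range s. m \<le> y"
    using wfp_on_Least[OF assms] by blast
  then show ?thesis by (metis not_le rangeE rangeI)
qed

lemma wfp_on_from_no_descent:
  fixes A :: "rat set"
  assumes "\<And>s. range s \<subseteq> A \<Longrightarrow> \<not> (\<forall>n. s (Suc n) < s n)"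
  shows "wfp_on A (<)"
  unfolding wfp_on_iff_ex_minimal
proof (intro allI impI, rule ccontr)
  fix B assume B: "B \<subseteq> A" "B \<noteq> {}" "\<not> (\<exists>z\<in>B. \<forall>y. y < z \<longrightarrow> y \<notin> B)"
  then obtain b where b: "b \<in> B" by blast
  from B have step: "\<forall>z\<in>B. \<exists>y. y \<in> B \<and> y < z" by blast
  have "\<exists>s. \<forall>n. s n \<in> B \<and> s (Suc n) < s n"
    using dependent_nat_choice[of "\<lambda>_ x. x \<in> B" "\<lambda>_ x y. y < x"] b step by metis
  then obtain s where "\<forall>n. s n \<in> B \<and> s (Suc n) < s n" by blast
  then show False using assms[of s] B(1) by (auto simp: image_subset_iff)
qed

lemma wfp_on_Un_rat:
  fixes A B :: "rat set"
  assumes "wfp_on A (<)" "wfp_on B (<)"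
  shows "wfp_on (A \<union> B) (<)"
  unfolding wfp_on_iff_ex_minimal
proof (intro allI impI)
  fix D assume D: "D \<subseteq> A \<union> B" "D \<noteq> {}"
  have 1: "D \<inter> A = {} \<or> (\<exists>m\<in>D \<inter> A. \<forall>y\<in>D \<inter> A. m \<le> y)"
    using wfp_on_Least[OF assms(1), of "D \<inter> A"] by blast
  have 2: "D \<inter> B = {} \<or> (\<exists>m\<in>D \<inter> B. \<forall>y\<in>D \<inter> B. m \<le> y)"
    using wfp_on_Least[OF assms(2), of "D \<inter> B"] by blast
  have "\<exists>m\<in>D. \<forall>y\<in>D. m \<le> y"
  proof (cases "D \<inter> A = {} \<or> D \<inter> B = {}")
    case True
    then show ?thesis using 1 2 D by blast
  next
    case False
    then obtain a b where "a \<in> D" "\<forall>y\<in>D \<inter> A. a \<le> y" "b \<in> D" "\<forall>y\<in>D \<inter> B. b \<le> y"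
      using 1 2 by blast
    then have "min a b \<in> D" "\<forall>y\<in>D. min a b \<le> y"
      using D(1) by (auto simp: min_def) (meson order_trans UnE subsetD nle_le IntI)+
    then show ?thesis by blast
  qed
  then show "\<exists>z\<in>D. \<forall>y. y < z \<longrightarrow> y \<notin> D" by (meson not_le)
qed

lemma wfp_on_sumset:
  fixes A B :: "rat set"
  assumes "wfp_on A (<)" "wfp_on B (<)"
  shows "wfp_on {a + b | a b. a \<in> A \<and> b \<in> B} (<)"
proof (rule wfp_on_from_no_descent, rule notI)
  fix s assume s: "range s \<subseteq> {a + b | a b. a \<in> A \<and> b \<in> B}"
    and dec: "\<forall>n. s (Suc n) < s n"
  from s have "\<forall>n. \<exists>a b. a \<in> A \<and> b \<in> B \<and> s n = a + b" by blast
  then obtain a b where ab: "\<And>n. a n \<in> A" "\<And>n. b n \<in> B" "\<And>n. s n = a n + b n" by metis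
  obtain h where h: "strict_mono (h :: nat \<Rightarrow> nat)" "monoseq (\<lambda>n. a (h n))"
    using seq_monosub[of a] by blast
  have sdec: "s n < s m" if "m < n" for m n
    using lift_Suc_mono_less[of "\<lambda>n. - s n" m n] dec that by simp
  have "\<exists>k. \<forall>n\<ge>k. a (h n) \<le> a (h (Suc n))"
  proof (cases "\<forall>m. \<forall>n\<ge>m. a (h m) \<le> a (h n)")
    case True then show ?thesis by (intro exI[of _ 0]) simp
  next
    case False
    then have mon: "\<forall>m. \<forall>n\<ge>m. a (h n) \<le> a (h m)" using h(2) unfolding monoseq_def by blast
    obtain k where k: "\<forall>y\<in>range (\<lambda>n. a (h n)). a (h k) \<le> y"
      using wfp_on_Least[OF assms(1), of "range (\<lambda>n. a (h n))"] ab(1) by auto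
    have "a (h n) = a (h k)" if "n \<ge> k" for n
      using mon k that by (meson antisym rangeI)
    then show ?thesis by (metis le_SucI order_refl)
  qed
  then obtain k where k: "\<forall>n\<ge>k. a (h n) \<le> a (h (Suc n))" by blast
  have "b (h (Suc (n + k))) < b (h (n + k))" for n
  proof -
    have "s (h (Suc (n + k))) < s (h (n + k))"
      using h(1) by (intro sdec) (simp add: strict_mono_def)
    moreover have "a (h (n + k)) \<le> a (h (Suc (n + k)))" using k by simp
    ultimately show ?thesis by (simp add: ab(3))
  qed
  then show False
    using wfp_on_no_descent[OF assms(2), of "\<lambda>n. b (h (n + k))"] ab(2) by auto
qed

lemma finite_sum_fibre:
  fixes A B :: "rat set"
  assumes "wfp_on A (<)" "wfp_on B (<)"
  shows "finite {(a, b). a \<in> A \<and> b \<in> B \<and> a + b = r}"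
proof -
  let ?E = "{a \<in> A. r - a \<in> B}"
  have "finite ?E"
  proof (rule ccontr)
    assume "infinite ?E"
    then obtain s :: "nat \<Rightarrow> rat" where s: "inj s" "range s \<subseteq> ?E"
      using infinite_countable_subset by blast
    obtain h where h: "strict_mono (h :: nat \<Rightarrow> nat)" "monoseq (\<lambda>n. s (h n))"
      using seq_monosub[of s] by blast
    have ne: "s (h (Suc n)) \<noteq> s (h n)" for n
      using s(1) h(1) by (metis inj_eq strict_mono_eq n_not_Suc_n)
    show False
    proof (cases "\<forall>n. s (h (Suc n)) \<le> s (h n)")
      case True
      then have "\<forall>n. s (h (Suc n)) < s (h n)" using ne by (metis less_le)
      moreover have "range (\<lambda>n. s (h n)) \<subseteq> A" using s(2) by blast
      ultimately show False using wfp_on_no_descent[OF assms(1)] by blast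
    next
      case False
      then have "\<forall>n. s (h n) \<le> s (h (Suc n))" using h(2) monoseq_Suc by metis
      then have "\<forall>n. r - s (h (Suc n)) < r - s (h n)" using ne by (metis less_le diff_strict_left_mono)
      moreover have "range (\<lambda>n. r - s (h n)) \<subseteq> B" using s(2) by blast
      ultimately show False using wfp_on_no_descent[OF assms(2)] by blast
    qed
  qed
  moreover have "{(a, b). a \<in> A \<and> b \<in> B \<and> a + b = r} \<subseteq> (\<lambda>a. (a, r - a)) ` ?E" by force
  ultimately show ?thesis using finite_surj by blast
qed

subsection \<open>Ring structure\<close>

instantiation hahn :: (field) "{zero, one, plus, minus, uminus, times}"
begin

lift_definition zero_hahn :: "'a hahn" is "\<lambda>_. 0" by (simp add: wfp_on_def)

lift_definition one_hahn :: "'a hahn" is "\<lambda>i. if i = 0 then 1 else 0"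
  by (auto simp: wfp_on_def)

lift_definition plus_hahn :: "'a hahn \<Rightarrow> 'a hahn \<Rightarrow> 'a hahn" is "\<lambda>x y i. x i + y i"
proof -
  fix x y :: "rat \<Rightarrow> 'a"
  assume "wfp_on {i. x i \<noteq> 0} (<)" "wfp_on {i. y i \<noteq> 0} (<)"
  then show "wfp_on {i. x i + y i \<noteq> 0} (<)"
    by (rule wfp_on_subset[OF wfp_on_Un_rat]) auto
qed

lift_definition uminus_hahn :: "'a hahn \<Rightarrow> 'a hahn" is "\<lambda>x i. - x i" by simp

definition minus_hahn :: "'a hahn \<Rightarrow> 'a hahn \<Rightarrow> 'a hahn" where
  "minus_hahn x y = x + - y"

lift_definition times_hahn :: "'a hahn \<Rightarrow> 'a hahn \<Rightarrow> 'a hahn" is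
  "\<lambda>x y r. \<Sum>(i, j) | x i \<noteq> 0 \<and> y j \<noteq> 0 \<and> i + j = r. x i * y j"
proof -
  fix x y :: "rat \<Rightarrow> 'a"
  assume "wfp_on {i. x i \<noteq> 0} (<)" "wfp_on {i. y i \<noteq> 0} (<)"
  from wfp_on_sumset[OF this]
  show "wfp_on {r. (\<Sum>(i, j) | x i \<noteq> 0 \<and> y j \<noteq> 0 \<and> i + j = r. x i * y j) \<noteq> 0} (<)"
  proof (rule wfp_on_subset, safe)
    fix r assume "(\<Sum>(i, j) | x i \<noteq> 0 \<and> y j \<noteq> 0 \<and> i + j = r. x i * y j) \<noteq> 0"
    then have "{(i, j). x i \<noteq> 0 \<and> y j \<noteq> 0 \<and> i + j = r} \<noteq> {}" by (metis sum.empty)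
    then show "\<exists>a b. r = a + b \<and> a \<in> {i. x i \<noteq> 0} \<and> b \<in> {i. y i \<noteq> 0}" by blast
  qed
qed

instance ..

end

lemma hahn_nth_0 [simp]: "hahn_nth 0 i = 0"
  and hahn_nth_1: "hahn_nth 1 i = (if i = 0 then 1 else 0)"
  and hahn_nth_add [simp]: "hahn_nth (x + y) i = hahn_nth x i + hahn_nth y i"
  and hahn_nth_uminus [simp]: "hahn_nth (- x) i = - hahn_nth x i"
  by (transfer; simp)+

lemma hahn_nth_minus [simp]: "hahn_nth (x - y) i = hahn_nth x i - hahn_nth y i"
  by (simp add: minus_hahn_def)

lemma hahn_nth_mult':
  "hahn_nth (x * y) r =
     (\<Sum>(i, j) | i \<in> hahn_supp x \<and> j \<in> hahn_supp y \<and> i + j = r. hahn_nth x i * hahn_nth y j)"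
  unfolding hahn_supp_def by transfer simp

lemma hahn_nth_mult:
  assumes "wfp_on A (<)" "wfp_on B (<)" "hahn_supp x \<subseteq> A" "hahn_supp y \<subseteq> B"
  shows "hahn_nth (x * y) r =
     (\<Sum>(i, j) | i \<in> A \<and> j \<in> B \<and> i + j = r. hahn_nth x i * hahn_nth y j)"
  unfolding hahn_nth_mult'
  using assms(3,4)
  by (intro sum.mono_neutral_left finite_sum_fibre assms) (auto simp: hahn_supp_def)

lemma hahn_supp_mult: "hahn_supp (x * y) \<subseteq> {a + b | a b. a \<in> hahn_supp x \<and> b \<in> hahn_supp y}"
proof
  fix r assume "r \<in> hahn_supp (x * y)"
  then have "{(i, j). i \<in> hahn_supp x \<and> j \<in> hahn_supp y \<and> i + j = r} \<noteq> {}"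
    unfolding hahn_supp_def[of "x * y"] hahn_nth_mult' by (metis (mono_tags) mem_Collect_eq sum.empty)
  then show "r \<in> {a + b | a b. a \<in> hahn_supp x \<and> b \<in> hahn_supp y}" by blast
qed

lemma hahn_mult_assoc: "(x * y) * z = x * (y * z)" for x y z :: "'a::field hahn"
proof (rule hahn_eqI)
  fix r
  let ?A = "hahn_supp x" and ?B = "hahn_supp y" and ?C = "hahn_supp z"
  let ?AB = "{a + b | a b. a \<in> ?A \<and> b \<in> ?B}" and ?BC = "{a + b | a b. a \<in> ?B \<and> b \<in> ?C}"
  note wf = wfp_on_hahn_supp
  note wfAB = wfp_on_sumset[OF wf[of x] wf[of y]] and wfBC = wfp_on_sumset[OF wf[of y] wf[of z]]
  let ?f = "\<lambda>(i, j, k). hahn_nth x i * hahn_nth y j * hahn_nth z k"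
  let ?T = "{(i, j, k). i \<in> ?A \<and> j \<in> ?B \<and> k \<in> ?C \<and> i + j + k = r}"
  let ?S1 = "SIGMA p:{(s, k). s \<in> ?AB \<and> k \<in> ?C \<and> s + k = r}. {(i, j). i \<in> ?A \<and> j \<in> ?B \<and> i + j = fst p}"
  let ?S2 = "SIGMA p:{(i, s). i \<in> ?A \<and> s \<in> ?BC \<and> i + s = r}. {(j, k). j \<in> ?B \<and> k \<in> ?C \<and> j + k = snd p}"
  have "hahn_nth ((x * y) * z) r =
      (\<Sum>p\<in>{(s, k). s \<in> ?AB \<and> k \<in> ?C \<and> s + k = r}.
        \<Sum>u\<in>{(i, j). i \<in> ?A \<and> j \<in> ?B \<and> i + j = fst p}. ?f (fst u, snd u, snd p))"
    unfolding hahn_nth_mult[OF wfAB wf hahn_supp_mult order_refl]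
    by (intro sum.cong refl)
       (auto simp: hahn_nth_mult' sum_distrib_right case_prod_beta)
  also have "\<dots> = (\<Sum>(p, u)\<in>?S1. ?f (fst u, snd u, snd p))"
    by (rule sum.Sigma[OF finite_sum_fibre[OF wfAB wf]]) (rule ballI, rule finite_sum_fibre[OF wf wf])
  also have "\<dots> = sum ?f ?T"
    by (rule sum.reindex_bij_witness[of _ "\<lambda>(i, j, k). ((i + j, k), (i, j))" "\<lambda>((s, k), (i, j)). (i, j, k)"])
       auto
  also have "\<dots> = (\<Sum>(p, u)\<in>?S2. ?f (fst p, fst u, snd u))"
    by (rule sum.reindex_bij_witness[of _ "\<lambda>((i, s), (j, k)). (i, j, k)" "\<lambda>(i, j, k). ((i, j + k), (j, k))"])
       (auto simp: add.assoc)
  also have "\<dots> = (\<Sum>p\<in>{(i, s). i \<in> ?A \<and> s \<in> ?BC \<and> i + s = r}.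
        \<Sum>u\<in>{(j, k). j \<in> ?B \<and> k \<in> ?C \<and> j + k = snd p}. ?f (fst p, fst u, snd u))"
    by (rule sum.Sigma[symmetric, OF finite_sum_fibre[OF wf wfBC]]) (rule ballI, rule finite_sum_fibre[OF wf wf])
  also have "\<dots> = hahn_nth (x * (y * z)) r"
    unfolding hahn_nth_mult[OF wf wfBC order_refl hahn_supp_mult]
    by (intro sum.cong refl)
       (auto simp: hahn_nth_mult' sum_distrib_left case_prod_beta mult.assoc)
  finally show "hahn_nth ((x * y) * z) r = hahn_nth (x * (y * z)) r" .
qed

lemma hahn_mult_commute: "x * y = y * x" for x y :: "'a::field hahn"
  by (rule hahn_eqI, unfold hahn_nth_mult')
     (rule sum.reindex_bij_witness[of _ prod.swap prod.swap]; auto simp: ac_simps)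

lemma hahn_supp_1: "hahn_supp (1 :: 'a::field hahn) = {0}"
  by (auto simp: hahn_supp_def hahn_nth_1)

lemma hahn_mult_1: "1 * x = x" for x :: "'a::field hahn"
proof (rule hahn_eqI)
  fix r
  have "{(i, j). i \<in> {0} \<and> j \<in> hahn_supp x \<and> i + j = r} =
      (if r \<in> hahn_supp x then {(0, r)} else {})"
    by auto
  then show "hahn_nth (1 * x) r = hahn_nth x r"
    by (auto simp: hahn_nth_mult' hahn_supp_1 hahn_nth_1) (simp add: hahn_supp_def)
qed

lemma hahn_supp_add: "hahn_supp (x + y) \<subseteq> hahn_supp x \<union> hahn_supp y"
  by (auto simp: hahn_supp_def)

lemma hahn_distrib: "(x + y) * z = x * z + y * z" for x y z :: "'a::field hahn"
proof (rule hahn_eqI)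
  fix r
  note wf = wfp_on_hahn_supp
  have U: "wfp_on (hahn_supp x \<union> hahn_supp y) (<)" by (intro wfp_on_Un_rat wf)
  show "hahn_nth ((x + y) * z) r = hahn_nth (x * z + y * z) r"
    using hahn_nth_mult[OF U wf hahn_supp_add order_refl, where r = r and y = z]
      hahn_nth_mult[OF U wf Un_upper1 order_refl, where r = r and y = z]
      hahn_nth_mult[OF U wf Un_upper2 order_refl, where r = r and y = z]
    by (simp add: sum.distrib[symmetric] case_prod_beta distrib_right)
qed

instance hahn :: (field) comm_ring_1
proof
  fix x y z :: "'a hahn"
  show "x * y * z = x * (y * z)" by (rule hahn_mult_assoc)
  show "x * y = y * x" by (rule hahn_mult_commute)
  show "1 * x = x" by (rule hahn_mult_1)
  show "(x + y) * z = x * z + y * z" by (rule hahn_distrib)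
  have "hahn_nth (0 :: 'a hahn) 0 \<noteq> hahn_nth 1 0" by (simp add: hahn_nth_1)
  then show "(0 :: 'a hahn) \<noteq> 1" by metis
qed (auto intro!: hahn_eqI)

subsection \<open>Order of a Hahn series, multiplicative inverses\<close>

definition hahn_ord :: "'a::zero hahn \<Rightarrow> rat" where
  "hahn_ord x = (LEAST i. hahn_nth x i \<noteq> 0)"

lift_definition hahn_monom :: "'a::zero \<Rightarrow> rat \<Rightarrow> 'a hahn" is
  "\<lambda>a r i. if i = r then a else 0"
  by (auto simp: wfp_on_def)

lemma hahn_nth_monom: "hahn_nth (hahn_monom a r) i = (if i = r then a else 0)"
  by transfer simp

lemma hahn_supp_monom: "hahn_supp (hahn_monom a r) \<subseteq> {r}"
  by (auto simp: hahn_supp_def hahn_nth_monom)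

lemma
  fixes x :: "'a::field hahn"
  assumes "x \<noteq> 0"
  shows hahn_nth_ord: "hahn_nth x (hahn_ord x) \<noteq> 0"
    and hahn_ord_le: "hahn_nth x i \<noteq> 0 \<Longrightarrow> hahn_ord x \<le> i"
proof -
  have "hahn_supp x \<noteq> {}" using assms by (auto simp: hahn_supp_def intro: hahn_eqI)
  then obtain m where m: "m \<in> hahn_supp x" "\<forall>y\<in>hahn_supp x. m \<le> y"
    using wfp_on_Least[OF wfp_on_hahn_supp order_refl] by blast
  then have "hahn_ord x = m" unfolding hahn_ord_def
    by (intro Least_equality) (auto simp: hahn_supp_def)
  then show "hahn_nth x (hahn_ord x) \<noteq> 0" "hahn_nth x i \<noteq> 0 \<Longrightarrow> hahn_ord x \<le> i"
    using m by (auto simp: hahn_supp_def)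
qed

lemma hahn_mult_low:
  fixes x y :: "'a::field hahn"
  assumes "\<And>i. hahn_nth x i \<noteq> 0 \<Longrightarrow> m \<le> i" "\<And>i. hahn_nth y i \<noteq> 0 \<Longrightarrow> n \<le> i"
  shows "hahn_nth (x * y) i \<noteq> 0 \<Longrightarrow> m + n \<le> i"
    and "hahn_nth (x * y) (m + n) = hahn_nth x m * hahn_nth y n"
proof -
  assume "hahn_nth (x * y) i \<noteq> 0"
  then have "i \<in> {a + b | a b. a \<in> hahn_supp x \<and> b \<in> hahn_supp y}"
    using hahn_supp_mult[of x y] by (auto simp: hahn_supp_def)
  then show "m + n \<le> i" using assms by (auto simp: hahn_supp_def intro!: add_mono)
next
  have *: "i = m \<and> j = n" if "hahn_nth x i \<noteq> 0" "hahn_nth y j \<noteq> 0" "i + j = m + n" for i j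
    using assms(1)[OF that(1)] assms(2)[OF that(2)] that(3) by linarith
  have "{(i, j). i \<in> hahn_supp x \<and> j \<in> hahn_supp y \<and> i + j = m + n} =
     (if hahn_nth x m \<noteq> 0 \<and> hahn_nth y n \<noteq> 0 then {(m, n)} else {})"
    by (auto simp: hahn_supp_def dest: *)
  then show "hahn_nth (x * y) (m + n) = hahn_nth x m * hahn_nth y n"
    by (auto simp: hahn_nth_mult')
qed

lemma
  fixes x y :: "'a::field hahn"
  assumes "x \<noteq> 0" "y \<noteq> 0"
  shows hahn_mult_nonzero: "x * y \<noteq> 0"
    and hahn_ord_mult: "hahn_ord (x * y) = hahn_ord x + hahn_ord y"
proof -
  note low = hahn_mult_low[where x = x and y = y, OF hahn_ord_le[OF assms(1)] hahn_ord_le[OF assms(2)]]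
  have nz: "hahn_nth (x * y) (hahn_ord x + hahn_ord y) \<noteq> 0"
    using low(2) hahn_nth_ord[OF assms(1)] hahn_nth_ord[OF assms(2)] by simp
  then show "x * y \<noteq> 0" by auto
  show "hahn_ord (x * y) = hahn_ord x + hahn_ord y"
    unfolding hahn_ord_def[of "x * y"] using nz low(1) by (intro Least_equality)
qed

lemma hahn_monom_mult: "hahn_monom a r * hahn_monom b s = hahn_monom (a * b) (r + s)"
  for a b :: "'a::field"
proof (rule hahn_eqI)
  fix i
  have "hahn_nth (hahn_monom a r * hahn_monom b s) i =
     (\<Sum>(k, l) | k \<in> {r} \<and> l \<in> {s} \<and> k + l = i. hahn_nth (hahn_monom a r) k * hahn_nth (hahn_monom b s) l)"
    by (rule hahn_nth_mult) (use hahn_supp_monom in \<open>auto simp: wfp_on_def\<close>)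
  also have "{(k, l). k \<in> {r} \<and> l \<in> {s} \<and> k + l = i} = (if i = r + s then {(r, s)} else {})" by auto
  finally show "hahn_nth (hahn_monom a r * hahn_monom b s) i = hahn_nth (hahn_monom (a * b) (r + s)) i"
    by (simp add: hahn_nth_monom)
qed

lemma hahn_monom_1_0: "hahn_monom (1 :: 'a::field) 0 = 1"
  by (rule hahn_eqI) (simp add: hahn_nth_monom hahn_nth_1)

lemma hahn_nth_mult_cong:
  fixes x y z :: "'a::field hahn"
  assumes "\<And>i. hahn_nth x i \<noteq> 0 \<Longrightarrow> 0 \<le> i" "\<And>i. i \<le> r \<Longrightarrow> hahn_nth y i = hahn_nth z i"
  shows "hahn_nth (x * y) r = hahn_nth (x * z) r"
  unfolding hahn_nth_mult'
proof (rule sum.cong)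
  have "j \<le> r" if "hahn_nth x i \<noteq> 0" "i + j = r" for i j
    using assms(1)[OF that(1)] that(2) by linarith
  then have "hahn_nth y j = hahn_nth z j" if "hahn_nth x i \<noteq> 0" "i + j = r" for i j
    using assms(2) that by blast
  then show "{(i, j). i \<in> hahn_supp x \<and> j \<in> hahn_supp y \<and> i + j = r} =
      {(i, j). i \<in> hahn_supp x \<and> j \<in> hahn_supp z \<and> i + j = r}"
    by (auto simp: hahn_supp_def)
next
  fix p assume p: "p \<in> {(i, j). i \<in> hahn_supp x \<and> j \<in> hahn_supp z \<and> i + j = r}"
  then have "snd p \<le> r" using assms(1)[of "fst p"] by (auto simp: hahn_supp_def)
  then show "(case p of (i, j) \<Rightarrow> hahn_nth x i * hahn_nth y j) =
      (case p of (i, j) \<Rightarrow> hahn_nth x i * hahn_nth z j)"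
    using assms(2) by (auto simp: case_prod_beta)
qed

lemma hahn_geometric:
  fixes e :: "'a::field hahn"
  assumes e: "\<And>i. hahn_nth e i \<noteq> 0 \<Longrightarrow> d \<le> i" and d: "d > 0"
  shows "\<exists>y. (1 - e) * y = 1"
proof -
  have pow: "of_nat n * d \<le> i" if "hahn_nth (e ^ n) i \<noteq> 0" for n i
    using that
  proof (induction n arbitrary: i)
    case 0
    then show ?case by (simp add: hahn_nth_1 split: if_splits)
  next
    case (Suc n)
    then have "d + of_nat n * d \<le> i"
      using hahn_mult_low(1)[where x = e and y = "e ^ n" and i = i, OF e Suc.IH] by simp
    then show ?case by (simp add: algebra_simps)
  qed
  define N where "N r = nat \<lceil>r / d\<rceil>" for r
  have N: "hahn_nth (e ^ n) r = 0" if "n > N s" "r \<le> s" for n r s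
  proof (rule ccontr)
    assume "hahn_nth (e ^ n) r \<noteq> 0"
    then have "of_nat n * d \<le> s" using pow that(2) order_trans by blast
    then have "of_nat n \<le> s / d" using d by (simp add: pos_le_divide_eq)
    then have "n \<le> N s" unfolding N_def by linarith
    with that(1) show False by simp
  qed
  define S where "S n = (\<Sum>k\<le>n. e ^ k)" for n
  have S_Suc: "S (Suc n) = S n + e ^ Suc n" for n by (simp add: S_def)
  have stab: "hahn_nth (S n) r = hahn_nth (S (N s)) r" if "r \<le> s" "n \<ge> N s" for n r s
    using that(2) by (induction n rule: dec_induct) (auto simp: S_Suc N[OF _ that(1)] simp del: power_Suc)
  define Y where "Y r = hahn_nth (S (N r)) r" for r
  have N_mono: "N r \<le> N s" if "r \<le> s" for r s
    unfolding N_def using that d by (intro nat_mono ceiling_mono divide_right_mono) auto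
  have Y: "Y r = hahn_nth (S (N s)) r" if "r \<le> s" for r s
    unfolding Y_def using stab[OF order_refl N_mono[OF that]] by simp
  have "wfp_on {r. Y r \<noteq> 0} (<)"
    unfolding wfp_on_iff_ex_minimal
  proof (intro allI impI)
    fix D assume D: "D \<subseteq> {r. Y r \<noteq> 0}" "D \<noteq> {}"
    then obtain s where s: "s \<in> D" by blast
    have "D \<inter> {..s} \<subseteq> hahn_supp (S (N s))" using D(1) Y by (auto simp: hahn_supp_def)
    from wfp_on_Least[OF wfp_on_hahn_supp this] obtain m where
      "m \<in> D" "m \<le> s" "\<forall>y\<in>D \<inter> {..s}. m \<le> y" using s by auto
    then have "\<forall>y. y < m \<longrightarrow> y \<notin> D" by (meson IntI atMost_iff less_imp_le not_le order_trans)
    then show "\<exists>z\<in>D. \<forall>y. y < z \<longrightarrow> y \<notin> D" using \<open>m \<in> D\<close> by blast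
  qed
  then have nY: "hahn_nth (Abs_hahn Y) = Y" by (simp add: Abs_hahn_inverse)
  have tel: "(1 - e) * S n = 1 - e ^ Suc n" for n
    by (induction n) (simp_all add: S_Suc distrib_left, simp_all add: S_def algebra_simps)
  have "(1 - e) * Abs_hahn Y = 1"
  proof (rule hahn_eqI)
    fix r
    have pos: "0 \<le> i" if "hahn_nth (1 - e) i \<noteq> 0" for i
      using that e[of i] d by (auto simp: hahn_nth_1 split: if_splits)
    have "hahn_nth ((1 - e) * Abs_hahn Y) r = hahn_nth ((1 - e) * S (N r)) r"
      using pos Y by (intro hahn_nth_mult_cong) (simp_all add: nY)
    also have "\<dots> = hahn_nth 1 r"
      using N[of r "Suc (N r)" r] by (simp add: tel del: power_Suc)
    finally show "hahn_nth ((1 - e) * Abs_hahn Y) r = hahn_nth 1 r" .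
  qed
  then show ?thesis by blast
qed

lemma hahn_inverse_exists:
  fixes x :: "'a::field hahn"
  assumes "x \<noteq> 0"
  shows "\<exists>y. x * y = 1"
proof -
  define m where "m = hahn_ord x"
  define u where "u = hahn_monom (inverse (hahn_nth x m)) (- m)"
  have xm: "hahn_nth x m \<noteq> 0" using assms hahn_nth_ord by (simp add: m_def)
  define e where "e = 1 - u * x"
  have ulow: "- m \<le> i" if "hahn_nth u i \<noteq> 0" for i
    using that by (simp add: u_def hahn_nth_monom split: if_splits)
  have xlow: "m \<le> i" if "hahn_nth x i \<noteq> 0" for i
    using that hahn_ord_le[OF assms] by (simp add: m_def)
  note low = hahn_mult_low[where x = u and y = x, OF ulow xlow]
  have e0: "hahn_nth e i = 0" if "i \<le> 0" for i
  proof (cases "i = 0")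
    case True
    have "hahn_nth (u * x) 0 = 1" using low(2) xm by (simp add: u_def hahn_nth_monom)
    then show ?thesis using True by (simp add: e_def hahn_nth_1)
  next
    case False
    then show ?thesis using low(1)[of i] that by (auto simp: e_def hahn_nth_1)
  qed
  have "\<exists>d>0. \<forall>i. hahn_nth e i \<noteq> 0 \<longrightarrow> d \<le> i"
  proof (cases "e = 0")
    case True then show ?thesis by (auto intro!: exI[of _ 1])
  next
    case False
    then show ?thesis using hahn_nth_ord[OF False] hahn_ord_le[OF False] e0 by (metis not_le)
  qed
  then obtain y where "(1 - e) * y = 1" using hahn_geometric by metis
  then have "x * (u * y) = 1" by (simp add: e_def algebra_simps)
  then show ?thesis by blast
qed

instantiation hahn :: (field) field
begin

definition inverse_hahn :: "'a hahn \<Rightarrow> 'a hahn" where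
  "inverse_hahn x = (if x = 0 then 0 else SOME y. x * y = 1)"

definition divide_hahn :: "'a hahn \<Rightarrow> 'a hahn \<Rightarrow> 'a hahn" where
  "divide_hahn x y = x * inverse y"

instance
proof
  fix x y :: "'a hahn"
  show "inverse x * x = 1" if "x \<noteq> 0"
    using someI_ex[OF hahn_inverse_exists[OF that]] that
    by (simp add: inverse_hahn_def mult.commute)
  show "x div y = x * inverse y" by (rule divide_hahn_def)
  show "inverse (0 :: 'a hahn) = 0" by (simp add: inverse_hahn_def)
qed

end

section \<open>Valued fields\<close>

definition absolute_value :: "('a::field \<Rightarrow> real) \<Rightarrow> bool" where
  "absolute_value v \<longleftrightarrow> (\<forall>x. 0 \<le> v x) \<and> (\<forall>x. v x = 0 \<longleftrightarrow> x = 0) \<and>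
     (\<forall>x y. v (x * y) = v x * v y) \<and> (\<forall>x y. v (x + y) \<le> v x + v y)"

text \<open>The absolute value \<open>c ^ (- min S)\<close> on Hahn series.\<close>

definition hahn_abs :: "real \<Rightarrow> 'a::field hahn \<Rightarrow> real" where
  "hahn_abs c x = (if x = 0 then 0 else c powr (- of_rat (hahn_ord x)))"

lemma hahn_abs_add_le_max:
  assumes "c > 1"
  shows "hahn_abs c (x + y) \<le> max (hahn_abs c x) (hahn_abs c y)"
proof (cases "x = 0 \<or> y = 0 \<or> x + y = 0")
  case True
  then show ?thesis by (auto simp: hahn_abs_def le_max_iff_disj)
next
  case False
  then have "hahn_nth x (hahn_ord (x + y)) \<noteq> 0 \<or> hahn_nth y (hahn_ord (x + y)) \<noteq> 0"
    using hahn_nth_ord[of "x + y"] by auto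
  then have "hahn_ord x \<le> hahn_ord (x + y) \<or> hahn_ord y \<le> hahn_ord (x + y)"
    using False hahn_ord_le by blast
  then show ?thesis using False assms by (auto simp: hahn_abs_def le_max_iff_disj of_rat_less_eq)
qed

lemma absolute_value_hahn_abs:
  assumes "c > 1"
  shows "absolute_value (hahn_abs c)"
proof -
  have nonneg: "0 \<le> hahn_abs c x" for x :: "'a hahn" using assms by (simp add: hahn_abs_def)
  have "hahn_abs c (x + y) \<le> hahn_abs c x + hahn_abs c y" for x y :: "'a hahn"
    using hahn_abs_add_le_max[OF assms, of x y] nonneg[of x] nonneg[of y] by linarith
  moreover have "hahn_abs c (x * y) = hahn_abs c x * hahn_abs c y" for x y :: "'a hahn"
    using hahn_ord_mult[of x y] by (auto simp: hahn_abs_def of_rat_add powr_add[symmetric])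
  moreover have "hahn_abs c x = 0 \<longleftrightarrow> x = 0" for x :: "'a hahn"
    using assms by (auto simp: hahn_abs_def)
  ultimately show ?thesis using nonneg unfolding absolute_value_def by blast
qed

text \<open>On \<open>F((1/\<theta>))\<close>, written as Laurent series in the variable \<open>X = 1/\<theta>\<close>, with \<open>|\<theta>| = q\<close>.\<close>

definition fls_abs :: "nat \<Rightarrow> 'a::field fls \<Rightarrow> real" where
  "fls_abs q s = (if s = 0 then 0 else real q powi (- fls_subdegree s))"

definition is_subfield :: "'a::field set \<Rightarrow> bool" where
  "is_subfield F \<longleftrightarrow> 0 \<in> F \<and> 1 \<in> F \<and>
     (\<forall>x\<in>F. \<forall>y\<in>F. x - y \<in> F \<and> x * y \<in> F) \<and> (\<forall>x\<in>F. inverse x \<in> F)"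

definition algebraic_over :: "'a::field set \<Rightarrow> 'a \<Rightarrow> bool" where
  "algebraic_over F x \<longleftrightarrow> (\<exists>P. P \<noteq> 0 \<and> (\<forall>i. coeff P i \<in> F) \<and> poly P x = 0)"

abbreviation transcendental_over :: "'a::field set \<Rightarrow> 'a \<Rightarrow> bool" where
  "transcendental_over F x \<equiv> \<not> algebraic_over F x"

text \<open>The field \<open>F(u)\<close>; a field of rational functions when \<open>u\<close> is transcendental over \<open>F\<close>.\<close>

definition adjoin :: "'a::field set \<Rightarrow> 'a \<Rightarrow> 'a set" where
  "adjoin F u = {poly P u / poly Q u | P Q.
     (\<forall>i. coeff P i \<in> F) \<and> (\<forall>i. coeff Q i \<in> F) \<and> poly Q u \<noteq> 0}"

definition is_algebraic_closure :: "'a::field set \<Rightarrow> 'a set \<Rightarrow> bool" where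
  "is_algebraic_closure F A \<longleftrightarrow> is_subfield A \<and> F \<subseteq> A \<and> (\<forall>x\<in>A. algebraic_over F x) \<and>
     (\<forall>P. (\<forall>i. coeff P i \<in> A) \<and> degree P > 0 \<longrightarrow> (\<exists>x\<in>A. poly P x = 0))"

definition is_completion :: "('a::field \<Rightarrow> real) \<Rightarrow> 'a set \<Rightarrow> 'a set \<Rightarrow> bool" where
  "is_completion v F L \<longleftrightarrow> is_subfield L \<and> F \<subseteq> L \<and>
     Metric_space.mcomplete L (\<lambda>x y. v (x - y)) \<and>
     Metric_space.mtopology L (\<lambda>x y. v (x - y)) closure_of F = L"

text \<open>The series \<open>f\<close> converges at \<open>x\<close> in \<open>L\<close>, with sum \<open>s\<close>.\<close>

definition fps_sums_to :: "('a::field \<Rightarrow> real) \<Rightarrow> 'a set \<Rightarrow> 'a fps \<Rightarrow> 'a \<Rightarrow> 'a \<Rightarrow> bool" where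
  "fps_sums_to v L f x s \<longleftrightarrow>
     limitin (Metric_space.mtopology L (\<lambda>x y. v (x - y)))
       (\<lambda>n. \<Sum>i<n. fps_nth f i * x ^ i) s sequentially"

definition field_embedding :: "('a::field \<Rightarrow> 'b::field) \<Rightarrow> bool" where
  "field_embedding h \<longleftrightarrow> h 1 = 1 \<and> (\<forall>x y. h (x + y) = h x + h y) \<and> (\<forall>x y. h (x * y) = h x * h y)"

section \<open>The field of rational functions in \<open>t\<close> and the operator \<open>\<tau>\<close>\<close>

definition hahn_t :: "'c::field hahn" where
  "hahn_t = hahn_monom 1 1"

definition C_t :: "'c::field hahn set" where
  "C_t = adjoin (range (\<lambda>a. hahn_monom a 0)) hahn_t"

definition C_t_x :: "'c::field hahn fls set" where
  "C_t_x = adjoin (fls_const ` C_t) fls_X"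

text \<open>The case distinction only matters for \<open>q = 0\<close>.\<close>

lift_definition tau :: "nat \<Rightarrow> 'c::field hahn \<Rightarrow> 'c hahn" is
  "\<lambda>q x i. if x i = 0 then 0 else x i ^ q"
proof -
  fix q :: nat and x :: "rat \<Rightarrow> 'c"
  assume "wfp_on {i. x i \<noteq> 0} (<)"
  then show "wfp_on {i. (if x i = 0 then 0 else x i ^ q) \<noteq> 0} (<)"
    by (rule wfp_on_subset) auto
qed

definition tau_fps :: "nat \<Rightarrow> 'c::field hahn fps \<Rightarrow> 'c hahn fps" where
  "tau_fps q f = Abs_fps (\<lambda>n. if q dvd n then tau q (fps_nth f (n div q)) else 0)"

end

theory Submission
  imports Defs "HOL-Computational_Algebra.Primes"
begin

text \<open>
  Mahler's method. Suppose that \<open>\<beta> = (\<tau>\<^sup>m f)(\<alpha>)\<close> is algebraic for some large \<open>m\<close>. Specialising the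
  functional equation at \<open>\<alpha>\<close> shows that every later value \<open>(\<tau>\<^sup>n f)(\<alpha>)\<close> is an affine expression in
  \<open>\<beta>\<close> whose coefficients are fractions of polynomials in \<open>t\<close> of degree \<open>O(q\<^sup>n)\<close>; this uses that
  \<open>\<tau>\<close> preserves the degree in \<open>t\<close>. Linear algebra gives a nonzero polynomial \<open>P\<close> of degree at most
  \<open>N\<close> in each of two variables such that \<open>F(x) = P(x, f(x))\<close> has order \<open>\<nu> \<ge> N\<^sup>2\<close> at \<open>0\<close>, and \<open>\<nu>\<close> is
  finite because \<open>f\<close> is transcendental. For large \<open>n\<close> the number \<open>(\<tau>\<^sup>n F)(\<alpha>)\<close> is nonzero of absolute
  value at most a constant times \<open>|\<alpha>|\<close> to the power \<open>N\<^sup>2 q\<^sup>n\<close>, whereas it is a polynomial in \<open>\<beta>\<close> of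
  degree and height \<open>O(N q\<^sup>n)\<close>, so that a Liouville inequality over \<open>C[t]\<close> bounds it from below by a
  constant to the power \<open>- N q\<^sup>n\<close>. This is a contradiction when \<open>N\<close> is large.
\<close>

section \<open>Linear systems\<close>

lemma is_subfieldD:
  assumes "is_subfield F"
  shows "0 \<in> F" "1 \<in> F" "x \<in> F \<Longrightarrow> y \<in> F \<Longrightarrow> x - y \<in> F" "x \<in> F \<Longrightarrow> y \<in> F \<Longrightarrow> x + y \<in> F"
    "x \<in> F \<Longrightarrow> y \<in> F \<Longrightarrow> x * y \<in> F" "x \<in> F \<Longrightarrow> - x \<in> F" "x \<in> F \<Longrightarrow> y \<in> F \<Longrightarrow> x / y \<in> F"
proof -
  show 0: "0 \<in> F" and "1 \<in> F"
    using assms by (auto simp: is_subfield_def)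
  show m: "x \<in> F \<Longrightarrow> y \<in> F \<Longrightarrow> x - y \<in> F" and t: "x \<in> F \<Longrightarrow> y \<in> F \<Longrightarrow> x * y \<in> F" for x y
    using assms by (auto simp: is_subfield_def)
  show u: "x \<in> F \<Longrightarrow> - x \<in> F" for x using m[OF 0, of x] by simp
  show "x \<in> F \<Longrightarrow> y \<in> F \<Longrightarrow> x + y \<in> F" using m[OF _ u, of x y] by simp
  show "x \<in> F \<Longrightarrow> y \<in> F \<Longrightarrow> x / y \<in> F"
    using t assms by (auto simp: is_subfield_def divide_inverse)
qed

lemma is_subfield_sum:
  assumes "is_subfield F" "\<And>i. i \<in> I \<Longrightarrow> f i \<in> F"
  shows "sum f I \<in> F"
  using assms(2) by (induction I rule: infinite_finite_induct) (auto intro: is_subfieldD[OF assms(1)])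

lemma is_subfield_power:
  assumes "is_subfield F" "x \<in> F"
  shows "x ^ n \<in> F"
  by (induction n) (auto intro: is_subfieldD[OF assms(1)] assms)

text \<open>Gaussian elimination, removing one equation together with one unknown. The solution is
  kept in a subfield \<open>F\<close> because the system for the auxiliary function has to be solved
  inside \<open>C_t\<close>, whereas the one behind the Liouville inequality is solved over all
  constants.\<close>

lemma homogeneous_system_nontrivial_solution:
  fixes A :: "'j \<Rightarrow> 'i \<Rightarrow> 'a::field"
  assumes "finite J" "finite I" "card J < card I" "is_subfield F"
    and "\<And>j i. j \<in> J \<Longrightarrow> i \<in> I \<Longrightarrow> A j i \<in> F"
  shows "\<exists>x. (\<forall>i\<in>I. x i \<in> F) \<and> (\<exists>i\<in>I. x i \<noteq> 0) \<and> (\<forall>j\<in>J. (\<Sum>i\<in>I. A j i * x i) = 0)"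
  using assms
proof (induction J arbitrary: I A rule: finite_induct)
  case empty
  then show ?case by (intro exI[of _ "\<lambda>_. 1"]) (auto intro: is_subfieldD simp: card_gt_0_iff)
next
  case (insert j J)
  note F = is_subfieldD[OF insert.prems(3)]
  show ?case
  proof (cases "\<forall>i\<in>I. A j i = 0")
    case True
    then have *: "(\<Sum>i\<in>I. A j i * x i) = 0" for x by (intro sum.neutral) auto
    show ?thesis using insert.IH[of I A] insert.prems insert.hyps * by auto
  next
    case False
    then obtain i0 where i0: "i0 \<in> I" "A j i0 \<noteq> 0" by blast
    \<comment> \<open>Row reduction with pivot \<open>A j i0\<close>: the multiple of row
      \<open>j\<close> subtracted from row \<open>j'\<close> makes the unknown \<open>i0\<close>
      disappear.\<close>
    define B where "B j' i = A j' i - A j' i0 * (A j i / A j i0)" for j' i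
    have "\<exists>x. (\<forall>i\<in>I - {i0}. x i \<in> F) \<and> (\<exists>i\<in>I - {i0}. x i \<noteq> 0) \<and>
        (\<forall>j\<in>J. (\<Sum>i\<in>I - {i0}. B j i * x i) = 0)"
      using insert.prems insert.hyps i0 by (intro insert.IH) (auto simp: B_def intro!: F)
    then obtain x where x: "\<And>i. i \<in> I - {i0} \<Longrightarrow> x i \<in> F" "\<exists>i\<in>I - {i0}. x i \<noteq> 0"
      "\<And>j. j \<in> J \<Longrightarrow> (\<Sum>i\<in>I - {i0}. B j i * x i) = 0" by blast
    define s where "s = (\<Sum>i\<in>I - {i0}. A j i * x i)"
    \<comment> \<open>The value at \<open>i0\<close> is the one forced by equation
      \<open>j\<close>.\<close>
    define y where "y = x(i0 := - s / A j i0)"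
    have sumy: "(\<Sum>i\<in>I. A j' i * y i) = (\<Sum>i\<in>I - {i0}. A j' i * x i) - A j' i0 * s / A j i0" for j'
      using insert.prems(1) i0 by (simp add: sum.remove[of I i0] y_def)
    have "(\<Sum>i\<in>I. A j' i * y i) = 0" if "j' \<in> insert j J" for j'
    proof (cases "j' = j")
      case True
      then show ?thesis using i0 unfolding sumy by (simp add: s_def)
    next
      case False
      have "(\<Sum>i\<in>I - {i0}. B j' i * x i)
          = (\<Sum>i\<in>I - {i0}. A j' i * x i) - A j' i0 * s / A j i0"
        by (simp add: B_def s_def left_diff_distrib sum_subtractf sum_distrib_left sum_distrib_right
            sum_divide_distrib mult.assoc)
      then show ?thesis using x(3)[of j'] False that unfolding sumy by auto
    qed
    moreover have "s \<in> F" unfolding s_def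
      using insert.prems x(1) by (intro is_subfield_sum) (auto intro: F)
    then have "\<forall>i\<in>I. y i \<in> F"
      using x(1) insert.prems i0 by (auto simp: y_def intro!: F)
    moreover have "\<exists>i\<in>I. y i \<noteq> 0" using x(2) by (auto simp: y_def)
    ultimately show ?thesis by blast
  qed
qed

section \<open>The absolute value on Hahn series\<close>

context
  fixes c :: real
  assumes c: "c > 1"
begin

lemma hahn_abs_nonneg [simp]: "0 \<le> hahn_abs c x"
  and hahn_abs_eq_0 [simp]: "hahn_abs c x = 0 \<longleftrightarrow> x = 0"
  and hahn_abs_mult: "hahn_abs c (x * y) = hahn_abs c x * hahn_abs c y"
  using absolute_value_hahn_abs[OF c] by (auto simp: absolute_value_def)

lemma hahn_abs_gt_0 [simp]: "0 < hahn_abs c x \<longleftrightarrow> x \<noteq> 0"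
  using hahn_abs_nonneg hahn_abs_eq_0 by (metis less_eq_real_def less_irrefl)

lemma hahn_abs_0 [simp]: "hahn_abs c 0 = 0"
  by simp

lemma hahn_abs_1 [simp]: "hahn_abs c 1 = 1"
  using hahn_abs_mult[of 1 1] hahn_abs_eq_0[of 1] by simp

lemma hahn_abs_power: "hahn_abs c (x ^ n) = hahn_abs c x ^ n"
  by (induction n) (auto simp: hahn_abs_mult)

lemma hahn_abs_minus [simp]: "hahn_abs c (- x) = hahn_abs c x" for x :: "'a::field hahn"
proof -
  have "hahn_abs c (- 1 :: 'a hahn) ^ 2 = 1" by (simp flip: hahn_abs_power)
  then have "hahn_abs c (- 1 :: 'a hahn) = 1"
    using hahn_abs_nonneg[of "- 1 :: 'a hahn"] by (smt (verit) power2_eq_1_iff)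
  then show ?thesis using hahn_abs_mult[of "- 1" x] by simp
qed

lemma hahn_abs_minus_commute: "hahn_abs c (x - y) = hahn_abs c (y - x)"
  using hahn_abs_minus[of "x - y"] by simp

lemma hahn_abs_add_le:
  assumes "hahn_abs c x \<le> b" "hahn_abs c y \<le> b"
  shows "hahn_abs c (x + y) \<le> b"
  using hahn_abs_add_le_max[OF c, of x y] assms by linarith

lemma hahn_abs_diff_le:
  assumes "hahn_abs c x \<le> b" "hahn_abs c y \<le> b"
  shows "hahn_abs c (x - y) \<le> b"
  using hahn_abs_add_le[of x b "- y"] assms by simp

lemma hahn_abs_sum_le:
  assumes "\<And>i. i \<in> I \<Longrightarrow> hahn_abs c (f i) \<le> b" "0 \<le> b"
  shows "hahn_abs c (sum f I) \<le> b"
  using assms by (induction I rule: infinite_finite_induct) (auto intro: hahn_abs_add_le)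

text \<open>The isosceles principle: \<open>x\<close> is the difference of \<open>x + y\<close> and
  \<open>y\<close>, and the smaller \<open>hahn_abs c y\<close> cannot be what bounds it.\<close>

lemma hahn_abs_add_eq:
  assumes "hahn_abs c y < hahn_abs c x"
  shows "hahn_abs c (x + y) = hahn_abs c x"
proof (rule antisym)
  show "hahn_abs c (x + y) \<le> hahn_abs c x" using assms by (intro hahn_abs_add_le) auto
  show "hahn_abs c x \<le> hahn_abs c (x + y)"
    using hahn_abs_add_le_max[OF c, of "x + y" "- y"] assms by simp
qed

lemma Metric_space_hahn: "Metric_space L (\<lambda>x y. hahn_abs c (x - y))"
proof
  fix x y z :: "'a hahn"
  show "hahn_abs c (x - z) \<le> hahn_abs c (x - y) + hahn_abs c (y - z)"
    using absolute_value_hahn_abs[OF c, where ?'a = 'a] unfolding absolute_value_def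
    by (metis diff_add_cancel add_diff_eq)
qed (auto simp: hahn_abs_minus_commute)

end

section \<open>Polynomials in \<open>t\<close>\<close>

text \<open>Polynomials in t of degree at most \<open>s\<close>, described by their support:
  \<open>tau\<close> keeps supports, so its effect on degrees can be read off at once.\<close>

definition tpoly :: "nat \<Rightarrow> 'c::field hahn set" where
  "tpoly s = {x. hahn_supp x \<subseteq> of_nat ` {..s}}"

lemma tpolyD: "x \<in> tpoly s \<Longrightarrow> hahn_nth x i \<noteq> 0 \<Longrightarrow> \<exists>k\<le>s. i = of_nat k"
  by (auto simp: tpoly_def hahn_supp_def)

lemma tpolyI: "(\<And>i. hahn_nth x i \<noteq> 0 \<Longrightarrow> \<exists>k\<le>s. i = of_nat k) \<Longrightarrow> x \<in> tpoly s"
  by (auto simp: tpoly_def hahn_supp_def)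

lemma tpoly_eq_0I: "x \<in> tpoly s \<Longrightarrow> (\<And>k. k \<le> s \<Longrightarrow> hahn_nth x (of_nat k) = 0) \<Longrightarrow> x = 0"
  by (rule hahn_eqI) (metis tpolyD hahn_nth_0)

lemma tpoly_mono: "s \<le> s' \<Longrightarrow> x \<in> tpoly s \<Longrightarrow> x \<in> tpoly s'"
  by (meson order_trans tpolyD tpolyI)

lemma tpoly_0 [simp]: "0 \<in> tpoly s"
  by (auto intro: tpolyI)

lemma tpoly_monom: "k \<le> s \<Longrightarrow> hahn_monom a (of_nat k) \<in> tpoly s"
  by (auto intro!: tpolyI simp: hahn_nth_monom split: if_splits)

lemma hahn_monom_0_0: "hahn_monom 1 0 = (1 :: 'c::field hahn)"
  by (rule hahn_eqI) (simp add: hahn_nth_monom hahn_nth_1)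

lemma tpoly_1 [simp]: "1 \<in> tpoly s"
  using tpoly_monom[of 0 s 1] by (simp add: hahn_monom_0_0)

lemma tpoly_add: "x \<in> tpoly s \<Longrightarrow> y \<in> tpoly s \<Longrightarrow> x + y \<in> tpoly s"
  using hahn_supp_add[of x y] by (auto simp: tpoly_def)

lemma tpoly_uminus: "x \<in> tpoly s \<Longrightarrow> - x \<in> tpoly s"
  by (auto simp: tpoly_def hahn_supp_def)

lemma tpoly_diff: "x \<in> tpoly s \<Longrightarrow> y \<in> tpoly s \<Longrightarrow> x - y \<in> tpoly s"
  using tpoly_add[OF _ tpoly_uminus] by fastforce

lemma tpoly_sum: "(\<And>i. i \<in> I \<Longrightarrow> f i \<in> tpoly s) \<Longrightarrow> sum f I \<in> tpoly s"
  by (induction I rule: infinite_finite_induct) (auto intro: tpoly_add)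

lemma tpoly_mult: "x \<in> tpoly s \<Longrightarrow> y \<in> tpoly s' \<Longrightarrow> x * y \<in> tpoly (s + s')"
proof (rule tpolyI)
  fix i assume x: "x \<in> tpoly s" and y: "y \<in> tpoly s'" and "hahn_nth (x * y) i \<noteq> 0"
  then have "i \<in> {a + b | a b. a \<in> hahn_supp x \<and> b \<in> hahn_supp y}"
    using hahn_supp_mult[of x y] by (auto simp: hahn_supp_def)
  then obtain a b where "i = a + b" "hahn_nth x a \<noteq> 0" "hahn_nth y b \<noteq> 0"
    by (auto simp: hahn_supp_def)
  then show "\<exists>k\<le>s + s'. i = of_nat k"
    using tpolyD[OF x, of a] tpolyD[OF y, of b] by (metis add_mono of_nat_add)
qed

lemma tpoly_mult_le: "x \<in> tpoly s \<Longrightarrow> y \<in> tpoly s' \<Longrightarrow> s + s' \<le> n \<Longrightarrow> x * y \<in> tpoly n"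
  using tpoly_mult tpoly_mono by blast

lemma tpoly_power: "x \<in> tpoly s \<Longrightarrow> x ^ n \<in> tpoly (n * s)"
  by (induction n) (auto intro: tpoly_mult)

lemma hahn_nth_monom_0_mult: "hahn_nth (hahn_monom a 0 * x) r = a * hahn_nth x r"
  for x :: "'c::field hahn"
proof -
  have "hahn_nth (hahn_monom a 0 * x) r =
      (\<Sum>(i, j) | i \<in> {0} \<and> j \<in> hahn_supp x \<and> i + j = r. hahn_nth (hahn_monom a 0) i * hahn_nth x j)"
    using wfp_on_hahn_supp by (intro hahn_nth_mult hahn_supp_monom order_refl) (auto simp: wfp_on_def)
  also have "{(i, j). i \<in> {0} \<and> j \<in> hahn_supp x \<and> i + j = r} =
      (if r \<in> hahn_supp x then {(0, r)} else {})"
    by auto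
  finally show ?thesis by (auto simp: hahn_nth_monom hahn_supp_def split: if_splits)
qed

lemma hahn_monom_mult:
  "hahn_monom a r * hahn_monom b s = hahn_monom (a * b) (r + s)" for a b :: "'c::field"
proof (rule hahn_eqI)
  fix i
  have "hahn_nth (hahn_monom a r * hahn_monom b s) i =
      (\<Sum>(i', j) | i' \<in> {r} \<and> j \<in> {s} \<and> i' + j = i. hahn_nth (hahn_monom a r) i' * hahn_nth (hahn_monom b s) j)"
    by (intro hahn_nth_mult hahn_supp_monom order_refl) (auto simp: wfp_on_def)
  also have "{(i', j). i' \<in> {r} \<and> j \<in> {s} \<and> i' + j = i} = (if i = r + s then {(r, s)} else {})"
    by auto
  finally show "hahn_nth (hahn_monom a r * hahn_monom b s) i = hahn_nth (hahn_monom (a * b) (r + s)) i"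
    by (simp add: hahn_nth_monom)
qed

lemma hahn_t_power: "hahn_t ^ k = (hahn_monom 1 (of_nat k) :: 'c::field hahn)"
  by (induction k) (auto simp: hahn_monom_0_0 hahn_t_def hahn_monom_mult)

lemma hahn_ord_tpoly:
  assumes "x \<in> tpoly s" "x \<noteq> 0"
  shows "0 \<le> hahn_ord x" "hahn_ord x \<le> of_nat s"
  using tpolyD[OF assms(1) hahn_nth_ord[OF assms(2)]] by auto

lemma hahn_abs_tpoly_le_1:
  assumes "c > 1" "x \<in> tpoly s"
  shows "hahn_abs c x \<le> 1"
proof (cases "x = 0")
  case False
  then have "c powr - of_rat (hahn_ord x) \<le> c powr 0"
    using hahn_ord_tpoly(1)[OF assms(2)] assms(1) by (intro powr_mono) auto
  then show ?thesis using False assms(1) by (simp add: hahn_abs_def)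
qed (simp add: hahn_abs_def)

text \<open>The order at t = 0 of a nonzero polynomial cannot exceed its degree. This plays the part
  of the bound 1 for nonzero integers in the classical Liouville inequality.\<close>

lemma hahn_abs_tpoly_ge:
  assumes "c > 1" "x \<in> tpoly s" "x \<noteq> 0"
  shows "1 / c ^ s \<le> hahn_abs c x"
proof -
  have "real_of_rat (hahn_ord x) \<le> of_rat (of_nat s)"
    using hahn_ord_tpoly(2)[OF assms(2,3)] by (simp only: of_rat_less_eq)
  then have "c powr - real s \<le> c powr - of_rat (hahn_ord x)"
    using assms(1) by (intro powr_mono) auto
  then show ?thesis using assms(1,3)
    by (simp add: hahn_abs_def powr_minus powr_realpow inverse_eq_divide)
qed

section \<open>The field \<open>C_t\<close> as fractions of polynomials in t\<close>

lemma tpoly_iff: "(\<exists>s. x \<in> tpoly s) \<longleftrightarrow> (\<exists>P. (\<forall>i. coeff P i \<in> range (\<lambda>a. hahn_monom a 0)) \<and> x = poly P hahn_t)"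
  for x :: "'c::field hahn"
proof
  assume "\<exists>s. x \<in> tpoly s"
  then obtain s where s: "x \<in> tpoly s" by blast
  define P where "P = (\<Sum>k\<le>s. monom (hahn_monom (hahn_nth x (of_nat k)) 0) k)"
  \<comment> \<open>The coefficients of \<open>P\<close> above its degree vanish, so zero has to be
    recognised as a constant too.\<close>
  have z: "0 = (hahn_monom 0 0 :: 'c hahn)" by (rule hahn_eqI) (simp add: hahn_nth_monom)
  have "coeff P i \<in> range (\<lambda>a. hahn_monom a 0)" for i
    using z by (auto simp: P_def coeff_sum)
  moreover have "x = poly P hahn_t"
  proof (rule hahn_eqI)
    fix i
    have nth_sum: "hahn_nth (\<Sum>k\<in>K. g k) i = (\<Sum>k\<in>K. hahn_nth (g k :: 'c hahn) i)" for K :: "nat set" and g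
      by (induction K rule: infinite_finite_induct) auto
    have "hahn_nth (poly P hahn_t) i = (\<Sum>k\<le>s. if i = of_nat k then hahn_nth x i else 0)"
      by (auto simp: P_def poly_sum poly_monom hahn_t_power hahn_monom_mult nth_sum hahn_nth_monom intro!: sum.cong)
    also have "\<dots> = hahn_nth x i"
    proof (cases "\<exists>k\<le>s. i = of_nat k")
      case True
      then show ?thesis by auto
    next
      case False
      then show ?thesis using tpolyD[OF s, of i] by auto
    qed
    finally show "hahn_nth x i = hahn_nth (poly P hahn_t) i" by simp
  qed
  ultimately show "\<exists>P. (\<forall>i. coeff P i \<in> range (\<lambda>a. hahn_monom a 0)) \<and> x = poly P hahn_t" by blast
next
  assume "\<exists>P. (\<forall>i. coeff P i \<in> range (\<lambda>a. hahn_monom a 0)) \<and> x = poly P hahn_t"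
  then obtain P where P: "\<And>i. coeff P i \<in> range (\<lambda>a. hahn_monom a 0)" "x = poly P hahn_t" by blast
  have "coeff P i * hahn_t ^ i \<in> tpoly (degree P)" if "i \<le> degree P" for i
  proof -
    obtain a where "coeff P i = hahn_monom a 0" using P(1) by blast
    then show ?thesis using that by (auto simp: hahn_t_power hahn_monom_mult intro: tpoly_monom)
  qed
  then have "x \<in> tpoly (degree P)"
    unfolding P(2) poly_altdef by (intro tpoly_sum) auto
  then show "\<exists>s. x \<in> tpoly s" by blast
qed

lemma C_t_iff: "x \<in> C_t \<longleftrightarrow> (\<exists>s u v. u \<in> tpoly s \<and> v \<in> tpoly s \<and> v \<noteq> 0 \<and> x = u / v)"
  for x :: "'c::field hahn"
proof -
  have "x \<in> C_t \<longleftrightarrow> (\<exists>u v. (\<exists>s. u \<in> tpoly s) \<and> (\<exists>s. v \<in> tpoly s) \<and> v \<noteq> 0 \<and> x = u / v)"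
    unfolding tpoly_iff C_t_def adjoin_def by blast
  also have "\<dots> \<longleftrightarrow> (\<exists>s u v. u \<in> tpoly s \<and> v \<in> tpoly s \<and> v \<noteq> 0 \<and> x = u / v)"
  proof safe
    fix u v :: "'c hahn" and s s' assume "u \<in> tpoly s" "v \<in> tpoly s'" "v \<noteq> 0"
    then have "u \<in> tpoly (max s s')" "v \<in> tpoly (max s s')"
      by (auto elim: tpoly_mono[rotated])
    with \<open>v \<noteq> 0\<close> show "\<exists>s ua va. ua \<in> tpoly s \<and> va \<in> tpoly s \<and> va \<noteq> 0 \<and> u / v = ua / va"
      by blast
  qed blast
  finally show ?thesis .
qed

lemma tpoly_in_C_t: "x \<in> tpoly s \<Longrightarrow> x \<in> C_t"
  unfolding C_t_iff by (intro exI[of _ s] exI[of _ x] exI[of _ 1]) auto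

lemma is_subfield_C_t: "is_subfield (C_t :: 'c::field hahn set)"
  unfolding is_subfield_def
proof (intro conjI ballI)
  show "0 \<in> C_t" "1 \<in> C_t" by (auto intro: tpoly_in_C_t[where s = 0])
next
  fix x y :: "'c hahn" assume "x \<in> C_t" "y \<in> C_t"
  then obtain s u v s' u' v' where
    x: "u \<in> tpoly s" "v \<in> tpoly s" "v \<noteq> 0" "x = u / v" and
    y: "u' \<in> tpoly s'" "v' \<in> tpoly s'" "v' \<noteq> 0" "y = u' / v'"
    unfolding C_t_iff by blast
  show "x - y \<in> C_t" unfolding C_t_iff
    by (rule exI[of _ "s + s'"], rule exI[of _ "u * v' - u' * v"], rule exI[of _ "v * v'"])
       (use x y in \<open>auto simp: diff_frac_eq intro!: tpoly_diff intro: tpoly_mult tpoly_mult_le\<close>)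
  show "x * y \<in> C_t" unfolding C_t_iff
    by (rule exI[of _ "s + s'"], rule exI[of _ "u * u'"], rule exI[of _ "v * v'"])
       (use x y in \<open>auto intro: tpoly_mult\<close>)
next
  fix x :: "'c hahn" assume "x \<in> C_t"
  then obtain s u v where x: "u \<in> tpoly s" "v \<in> tpoly s" "v \<noteq> 0" "x = u / v"
    unfolding C_t_iff by blast
  show "inverse x \<in> C_t"
  proof (cases "u = 0")
    case True
    then show ?thesis using \<open>x \<in> C_t\<close> x by simp
  next
    case False
    then show ?thesis unfolding C_t_iff
      by (intro exI[of _ s] exI[of _ v] exI[of _ u]) (use x in auto)
  qed
qed

text \<open>The denominator is the product of the individual ones; a single bound \<open>s\<close>
  for it and for all numerators keeps the later degree counts short.\<close>

lemma C_t_common_denominator: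
  assumes "finite I" "\<And>i. i \<in> I \<Longrightarrow> x i \<in> (C_t :: 'c::field hahn set)"
  shows "\<exists>s w. w \<in> tpoly s \<and> w \<noteq> 0 \<and> (\<forall>i\<in>I. w * x i \<in> tpoly s)"
  using assms
proof (induction I rule: finite_induct)
  case empty
  show ?case by (intro exI[of _ 0] exI[of _ 1]) auto
next
  case (insert j I)
  then obtain s w where w: "w \<in> tpoly s" "w \<noteq> 0" "\<forall>i\<in>I. w * x i \<in> tpoly s" by auto
  obtain s' u v where j: "u \<in> tpoly s'" "v \<in> tpoly s'" "v \<noteq> 0" "x j = u / v"
    using insert.prems[of j] unfolding C_t_iff by blast
  have "w * v * x i \<in> tpoly (s + s')" if "i \<in> insert j I" for i
  proof (cases "i = j")
    case True
    then show ?thesis using j w by (auto intro: tpoly_mult)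
  next
    case False
    then have "(w * x i) * v \<in> tpoly (s + s')" using that w j by (intro tpoly_mult) auto
    then show ?thesis by (simp add: ac_simps)
  qed
  then show ?case using w j by (intro exI[of _ "s + s'"] exI[of _ "w * v"]) (auto intro: tpoly_mult)
qed

section \<open>A Liouville inequality\<close>

text \<open>A filtration of the ring C[t][\<beta>]: \<open>N\<close> measures the degree in \<beta>
  and \<open>s\<close> the height, which is the degree in t.\<close>

definition poly_values :: "'c::field hahn \<Rightarrow> nat \<Rightarrow> nat \<Rightarrow> 'c hahn set" where
  "poly_values \<beta> N s = {poly g \<beta> | g. degree g \<le> N \<and> (\<forall>k. coeff g k \<in> tpoly s)}"

lemma poly_valuesI: "degree g \<le> N \<Longrightarrow> (\<And>k. coeff g k \<in> tpoly s) \<Longrightarrow> poly g \<beta> \<in> poly_values \<beta> N s"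
  by (auto simp: poly_values_def)

lemma poly_valuesE:
  assumes "x \<in> poly_values \<beta> N s"
  obtains g where "x = poly g \<beta>" "degree g \<le> N" "\<And>k. coeff g k \<in> tpoly s"
  using assms by (auto simp: poly_values_def)

lemma poly_values_mono:
  "x \<in> poly_values \<beta> N s \<Longrightarrow> N \<le> N' \<Longrightarrow> s \<le> s' \<Longrightarrow> x \<in> poly_values \<beta> N' s'"
  unfolding poly_values_def by (blast intro: order_trans tpoly_mono)

lemma poly_values_tpoly: "x \<in> tpoly s \<Longrightarrow> x \<in> poly_values \<beta> N s"
  using poly_valuesI[of "[:x:]" N s \<beta>] by (simp add: coeff_pCons split: nat.split)

lemma poly_values_self: "\<beta> \<in> poly_values \<beta> (Suc 0) 0"
  using poly_valuesI[of "[:0, 1:]" "Suc 0" 0 \<beta>] by (simp add: coeff_pCons split: nat.split)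

lemma poly_values_add:
  assumes "x \<in> poly_values \<beta> N s" "y \<in> poly_values \<beta> N s"
  shows "x + y \<in> poly_values \<beta> N s"
proof -
  obtain g h where "x = poly g \<beta>" "degree g \<le> N" "\<And>k. coeff g k \<in> tpoly s"
    "y = poly h \<beta>" "degree h \<le> N" "\<And>k. coeff h k \<in> tpoly s"
    using assms by (metis poly_valuesE)
  then show ?thesis using poly_valuesI[of "g + h" N s \<beta>]
    by (simp add: degree_add_le tpoly_add)
qed

lemma poly_values_sum:
  "(\<And>i. i \<in> I \<Longrightarrow> f i \<in> poly_values \<beta> N s) \<Longrightarrow> sum f I \<in> poly_values \<beta> N s"
  by (induction I rule: infinite_finite_induct)
     (auto intro: poly_values_add poly_values_tpoly)

lemma poly_values_mult:
  assumes "x \<in> poly_values \<beta> N s" "y \<in> poly_values \<beta> N' s'"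
  shows "x * y \<in> poly_values \<beta> (N + N') (s + s')"
proof -
  obtain g h where "x = poly g \<beta>" "degree g \<le> N" "\<And>k. coeff g k \<in> tpoly s"
    "y = poly h \<beta>" "degree h \<le> N'" "\<And>k. coeff h k \<in> tpoly s'"
    using assms by (metis poly_valuesE)
  moreover from this have "coeff (g * h) k \<in> tpoly (s + s')" for k
    unfolding coeff_mult by (intro tpoly_sum tpoly_mult)
  moreover from calculation have "degree (g * h) \<le> N + N'"
    by (meson add_mono degree_mult_le order_trans)
  ultimately show ?thesis using poly_valuesI[of "g * h" "N + N'" "s + s'" \<beta>] by simp
qed

lemma poly_values_power: "x \<in> poly_values \<beta> N s \<Longrightarrow> x ^ k \<in> poly_values \<beta> (k * N) (k * s)"
  by (induction k) (auto intro: poly_values_mult poly_values_tpoly)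

lemma poly_values_power_self: "\<beta> ^ k \<in> poly_values \<beta> k 0"
  using poly_values_power[OF poly_values_self, of \<beta> k] by simp

text \<open>The minimality of the degree replaces irreducibility of the polynomial.\<close>

lemma minimal_tpoly_equation:
  assumes "algebraic_over C_t \<beta>"
  obtains M m where "degree M > 0" "poly M \<beta> = 0" "\<And>k. coeff M k \<in> tpoly m"
    "\<And>g s. g \<noteq> 0 \<Longrightarrow> degree g < degree M \<Longrightarrow> (\<And>k. coeff g k \<in> tpoly s) \<Longrightarrow> poly g \<beta> \<noteq> 0"
proof -
  let ?Q = "\<lambda>M. M \<noteq> 0 \<and> poly M \<beta> = 0 \<and> (\<exists>m. \<forall>k. coeff M k \<in> tpoly m)"
  obtain P where P: "P \<noteq> 0" "\<And>i. coeff P i \<in> C_t" "poly P \<beta> = 0"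
    using assms unfolding algebraic_over_def by blast
  obtain s w where w: "w \<in> tpoly s" "w \<noteq> 0" "\<forall>i\<in>{..degree P}. w * coeff P i \<in> tpoly s"
    using C_t_common_denominator[of "{..degree P}" "coeff P"] P(2) by auto
  have "w * coeff P i \<in> tpoly s" for i
    using w(3) by (cases "i \<le> degree P") (auto simp: coeff_eq_0)
  then have "?Q (smult w P)" using P w by auto
  then obtain M where M: "?Q M" "\<And>g. degree g < degree M \<Longrightarrow> \<not> ?Q g"
    using ex_has_least_nat[of ?Q "smult w P" degree] by (metis not_le)
  then obtain m where m: "\<And>k. coeff M k \<in> tpoly m" by blast
  have "degree M > 0"
  proof (rule ccontr)
    assume "\<not> degree M > 0"
    then obtain a where "M = [:a:]" by (auto elim: degree_eq_zeroE)
    then show False using M(1) by auto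
  qed
  then show ?thesis using that[of M m] M m by blast
qed

text \<open>Pseudo-division by \<open>M\<close>. Each factor \<beta> may push the degree in \<beta>
  to \<open>Suc d\<close>; one factor \<open>lead_coeff M\<close> then lets the top term be replaced
  through \<open>poly M \<beta> = 0\<close>, at the price of \<open>m\<close> in the degree in t. At
  most \<open>N\<close> such steps are needed.\<close>

lemma poly_values_reduce:
  assumes M: "degree M = Suc d" "poly M \<beta> = 0" "\<And>k. coeff M k \<in> tpoly m"
    and x: "x \<in> poly_values \<beta> N s"
  shows "lead_coeff M ^ N * x \<in> poly_values \<beta> d (s + m * N)"
proof -
  let ?l = "lead_coeff M"
  have step: "?l * \<beta> * y \<in> poly_values \<beta> d (n + m)" if y: "y \<in> poly_values \<beta> d n" for y n
  proof -
    obtain g where g: "y = poly g \<beta>" "degree g \<le> d" "\<And>k. coeff g k \<in> tpoly n"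
      using y by (metis poly_valuesE)
    \<comment> \<open>The two contributions at \<open>Suc d\<close> cancel, and the multiple of
      \<open>M\<close> does not change the value at \<beta>.\<close>
    define h where "h = smult ?l (pCons 0 g) - smult (coeff g d) M"
    have "degree h \<le> d"
    proof (rule degree_le, intro allI impI)
      fix i assume i: "d < i"
      show "coeff h i = 0"
      proof (cases "i = Suc d")
        case True
        then show ?thesis using M(1) by (simp add: h_def coeff_pCons)
      next
        case False
        then have "Suc d < i" using i by simp
        then show ?thesis using M(1) g(2) by (simp add: h_def coeff_pCons coeff_eq_0 split: nat.split)
      qed
    qed
    moreover have "?l * coeff g i \<in> tpoly (n + m)" "coeff g i * coeff M k \<in> tpoly (n + m)" for i k
      using g(3) M(3) tpoly_mult_le[of ?l m "coeff g i" n] by (auto intro: tpoly_mult)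
    then have "coeff h k \<in> tpoly (n + m)" for k
      by (auto simp: h_def coeff_pCons split: nat.split intro: tpoly_diff tpoly_uminus)
    moreover have "poly h \<beta> = ?l * \<beta> * y" using M(2) g(1) by (simp add: h_def)
    ultimately show ?thesis using poly_valuesI[of h d "n + m" \<beta>] by simp
  qed
  have pow: "?l ^ k * \<beta> ^ k \<in> poly_values \<beta> d (m * k)" for k
  proof (induction k)
    case 0
    show ?case by (simp add: poly_values_tpoly)
  next
    case (Suc k)
    from step[OF this] show ?case by (simp add: algebra_simps)
  qed
  obtain g where g: "x = poly g \<beta>" "degree g \<le> N" "\<And>k. coeff g k \<in> tpoly s"
    using x by (metis poly_valuesE)
  \<comment> \<open>The factor \<open>?l ^ N\<close> is split: \<open>k\<close> powers reduce
    \<open>\<beta> ^ k\<close>, the other \<open>N - k\<close> go into the coefficient.\<close>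
  have "?l ^ N * x = (\<Sum>k\<le>degree g. (coeff g k * ?l ^ (N - k)) * (?l ^ k * \<beta> ^ k))"
    unfolding g(1) poly_altdef sum_distrib_left
  proof (intro sum.cong refl)
    fix k assume "k \<in> {..degree g}"
    then have "?l ^ N = ?l ^ (N - k) * ?l ^ k" using g(2) by (simp flip: power_add)
    then show "?l ^ N * (coeff g k * \<beta> ^ k) = coeff g k * ?l ^ (N - k) * (?l ^ k * \<beta> ^ k)"
      by (simp add: ac_simps)
  qed
  also have "\<dots> \<in> poly_values \<beta> d (s + m * N)"
  proof (intro poly_values_sum)
    fix k assume k: "k \<in> {..degree g}"
    then have kN: "k \<le> N" using g(2) by simp
    have "coeff g k * ?l ^ (N - k) \<in> poly_values \<beta> 0 (s + (N - k) * m)"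
      using g(3) M(3) by (intro poly_values_tpoly tpoly_mult tpoly_power)
    from poly_values_mult[OF this pow[of k]]
    have "(coeff g k * ?l ^ (N - k)) * (?l ^ k * \<beta> ^ k) \<in> poly_values \<beta> d (s + (N - k) * m + m * k)"
      by simp
    also have "s + (N - k) * m + m * k = s + m * N" using kN by (auto simp: algebra_simps dest!: le_Suc_ex)
    finally show "(coeff g k * ?l ^ (N - k)) * (?l ^ k * \<beta> ^ k) \<in> poly_values \<beta> d (s + m * N)" .
  qed
  finally show ?thesis .
qed

text \<open>The coefficients in \<open>C\<close> of \<open>v\<close> solve a linear system with more unknowns than equations, which
  expresses that \<open>x * poly v \<beta>\<close> has no component along \<open>\<beta> ^ j\<close> for \<open>j > 0\<close>.\<close>

lemma tpoly_multiple:
  fixes \<beta> :: "'c::field hahn"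
  assumes x: "\<And>i. i \<le> d \<Longrightarrow> x * \<beta> ^ i \<in> poly_values \<beta> d s"
  obtains v where "v \<noteq> 0" "degree v \<le> d" "\<And>k. coeff v k \<in> tpoly (d * s)"
    "x * poly v \<beta> \<in> tpoly (Suc d * s)"
proof -
  have "\<exists>g. x * \<beta> ^ i = poly g \<beta> \<and> degree g \<le> d \<and> (\<forall>k. coeff g k \<in> tpoly s)" if "i \<le> d" for i
    using x[OF that] by (metis poly_valuesE)
  then obtain g where g: "\<And>i. i \<le> d \<Longrightarrow> x * \<beta> ^ i = poly (g i) \<beta>" "\<And>i. i \<le> d \<Longrightarrow> degree (g i) \<le> d"
    "\<And>i k. i \<le> d \<Longrightarrow> coeff (g i) k \<in> tpoly s" by metis
  \<comment> \<open>With this bound for the degree of \<open>v\<close> in t there are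
    \<open>Suc d * (T + 1)\<close> unknowns and \<open>d * (T + s + 1)\<close> equations; the
    difference \<open>T + 1 - d * s\<close> is 1.\<close>
  define T where "T = d * s"
  let ?t = "\<lambda>k. hahn_monom 1 (of_nat k) :: 'c hahn"
  \<comment> \<open>An index \<open>(i, k)\<close> in \<open>I\<close> stands for the monomial
    \<open>t ^ k * \<beta> ^ i\<close> of \<open>v\<close>, an index \<open>(l, r)\<close> in
    \<open>J\<close> for the coefficient of \<open>t ^ r * \<beta> ^ l\<close> in the product;
    \<open>l = 0\<close> is left out because the constant component may stay.\<close>
  define I where "I = {..d} \<times> {..T}"
  define J where "J = {1..d} \<times> {..T + s}"
  define A where "A j i = hahn_nth (?t (snd i) * coeff (g (fst i)) (fst j)) (of_nat (snd j))"
    for j i :: "nat \<times> nat"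
  have "card J = d * (T + s + 1)" "card I = Suc d * (T + 1)" by (simp_all add: I_def J_def)
  then have "card J < card I" by (simp add: T_def algebra_simps)
  then have "\<exists>y. (\<forall>i\<in>I. y i \<in> (UNIV :: 'c set)) \<and> (\<exists>i\<in>I. y i \<noteq> 0) \<and> (\<forall>j\<in>J. (\<Sum>i\<in>I. A j i * y i) = 0)"
    by (intro homogeneous_system_nontrivial_solution) (auto simp: I_def J_def is_subfield_def)
  then obtain y where y: "\<exists>i\<in>I. y i \<noteq> 0" "\<And>j. j \<in> J \<Longrightarrow> (\<Sum>i\<in>I. A j i * y i) = 0" by blast
  define a where "a i = hahn_monom (y i) 0 * ?t (snd i)" for i
  have a: "a i \<in> tpoly T" if "i \<in> I" for i
    using that by (auto simp: a_def I_def hahn_monom_mult intro: tpoly_monom)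
  define v where "v = (\<Sum>i\<in>I. monom (a i) (fst i))"
  \<comment> \<open>Replacing each \<open>x * \<beta> ^ i\<close> by
    \<open>poly (g i) \<beta>\<close> turns \<open>x * poly v \<beta>\<close> into the value of
    \<open>w\<close>.\<close>
  define w where "w = (\<Sum>i\<in>I. smult (a i) (g (fst i)))"
  have nth_sum: "hahn_nth (sum f K) r = (\<Sum>k\<in>K. hahn_nth (f k :: 'c hahn) r)" for K :: "(nat \<times> nat) set" and f r
    by (induction K rule: infinite_finite_induct) auto
  have w_eq: "x * poly v \<beta> = poly w \<beta>"
    using g(1) by (auto simp: v_def w_def poly_sum poly_monom sum_distrib_left I_def ac_simps intro!: sum.cong)
  have w_coeff: "coeff w k \<in> tpoly (T + s)" for k
    using a g(3) by (auto simp: w_def coeff_sum I_def intro!: tpoly_sum tpoly_mult)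
  have "coeff w k = 0" if "k > 0" for k
  proof (cases "k \<le> d")
    case True
    show ?thesis
    proof (rule tpoly_eq_0I[OF w_coeff])
      fix r assume "r \<le> T + s"
      then have "(k, r) \<in> J" using True that by (simp add: J_def)
      from y(2)[OF this] show "hahn_nth (coeff w k) (of_nat r) = 0"
        by (simp add: w_def coeff_sum nth_sum a_def mult.assoc hahn_nth_monom_0_mult A_def)
           (simp add: mult.commute)
    qed
  next
    case False
    have "coeff (g (fst i)) k = 0" if "i \<in> I" for i
      using g(2)[of "fst i"] that False by (intro coeff_eq_0) (auto simp: I_def)
    then show ?thesis by (simp add: w_def coeff_sum)
  qed
  then have "degree w = 0" by (meson degree_le le_zero_eq)
  then have "poly w \<beta> = coeff w 0" by (auto elim: degree_eq_zeroE)
  then have "x * poly v \<beta> \<in> tpoly (Suc d * s)" using w_coeff[of 0] w_eq by (simp add: T_def add.commute)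
  moreover have "v \<noteq> 0"
  proof -
    obtain i k where ik: "i \<le> d" "k \<le> T" "y (i, k) \<noteq> 0" using y(1) by (auto simp: I_def)
    \<comment> \<open>Distinct indices give distinct monomials, so nothing cancels in
      \<open>v\<close>.\<close>
    have "hahn_nth (coeff v i) (of_nat k) = (\<Sum>p\<in>I. if p = (i, k) then y p else 0)"
      unfolding v_def coeff_sum nth_sum
      by (intro sum.cong refl) (auto simp: a_def hahn_monom_mult hahn_nth_monom)
    also have "\<dots> = y (i, k)" using ik by (simp add: I_def)
    finally show ?thesis using ik by auto
  qed
  moreover have "degree v \<le> d"
    unfolding v_def by (intro degree_sum_le) (auto simp: I_def intro: order_trans[OF degree_monom_le])
  moreover have "coeff v k \<in> tpoly (d * s)" for k
    using a by (auto simp: v_def coeff_sum T_def intro!: tpoly_sum)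
  ultimately show ?thesis using that by blast
qed

text \<open>A multiplier replaces the norm. A power of the leading coefficient times a suitable
  \<open>poly v \<beta>\<close> carries \<open>x\<close> to a nonzero polynomial in t of controlled
  degree, whose absolute value is bounded below, while both multipliers are bounded above.\<close>

theorem liouville_inequality:
  assumes c: "c > 1" and "algebraic_over C_t \<beta>"
  obtains \<kappa> D where "\<kappa> > 0"
    "\<And>N s x. x \<in> poly_values \<beta> N s \<Longrightarrow> x \<noteq> 0 \<Longrightarrow> \<kappa> / c ^ (D * (s + N)) \<le> hahn_abs c x"
proof -
  obtain M m where M: "degree M > 0" "poly M \<beta> = 0" "\<And>k. coeff M k \<in> tpoly m"
    and indep: "\<And>g s. g \<noteq> 0 \<Longrightarrow> degree g < degree M \<Longrightarrow> (\<And>k. coeff g k \<in> tpoly s) \<Longrightarrow> poly g \<beta> \<noteq> 0"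
    using minimal_tpoly_equation[OF assms(2)] by metis
  obtain d where d: "degree M = Suc d" using M(1) gr0_implies_Suc by blast
  define l where "l = lead_coeff M"
  have l: "l \<noteq> 0" "l \<in> tpoly m" using M by (auto simp: l_def)
  \<comment> \<open>This bounds \<open>poly v \<beta>\<close>, whose coefficients have absolute
    value at most 1 and whose degree is at most \<open>d\<close>.\<close>
  define B where "B = max 1 (hahn_abs c \<beta>) ^ d"
  have B: "B > 0" by (simp add: B_def)
  define D where "D = Suc d * Suc m"
  define \<kappa> where "\<kappa> = 1 / (B * c ^ (Suc d * (m * d)))"
  have "\<kappa> > 0" using B c by (simp add: \<kappa>_def)
  moreover have "\<kappa> / c ^ (D * (s + N)) \<le> hahn_abs c x"
    if x: "x \<in> poly_values \<beta> N s" and "x \<noteq> 0" for N s x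
  proof -
    \<comment> \<open>The products \<open>x * \<beta> ^ i\<close> with \<open>i \<le> d\<close> have
      degree at most \<open>N + d\<close> in \<beta>, and the reduction costs \<open>m\<close> per
      degree.\<close>
    define s' where "s' = s + m * (N + d)"
    define x' where "x' = l ^ (N + d) * x"
    have "x' * \<beta> ^ i \<in> poly_values \<beta> d s'" if "i \<le> d" for i
    proof -
      have "x * \<beta> ^ i \<in> poly_values \<beta> (N + d) s"
        using poly_values_mult[OF x poly_values_power_self[of \<beta> i]] that
        by (elim poly_values_mono) auto
      from poly_values_reduce[OF d M(2,3) this] show ?thesis
        by (simp add: x'_def s'_def l_def mult.assoc)
    qed
    then obtain v where v: "v \<noteq> 0" "degree v \<le> d" "\<And>k. coeff v k \<in> tpoly (d * s')"
      "x' * poly v \<beta> \<in> tpoly (Suc d * s')"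
      using tpoly_multiple by blast
    \<comment> \<open>The minimality of \<open>degree M\<close> enters here, as
      \<open>degree v \<le> d < degree M\<close>.\<close>
    have "poly v \<beta> \<noteq> 0" using v d by (intro indep) auto
    then have "1 / c ^ (Suc d * s') \<le> hahn_abs c (x' * poly v \<beta>)"
      using v(4) \<open>x \<noteq> 0\<close> l c by (intro hahn_abs_tpoly_ge) (auto simp: x'_def)
    also have "\<dots> = hahn_abs c (l ^ (N + d)) * hahn_abs c x * hahn_abs c (poly v \<beta>)"
      by (simp add: x'_def hahn_abs_mult[OF c])
    also have "\<dots> \<le> 1 * hahn_abs c x * B"
    proof (intro mult_mono)
      show "hahn_abs c (l ^ (N + d)) \<le> 1"
        by (rule hahn_abs_tpoly_le_1[OF c tpoly_power[OF l(2)]])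
      show "hahn_abs c (poly v \<beta>) \<le> B"
        unfolding poly_altdef
      proof (intro hahn_abs_sum_le[OF c])
        fix i assume i: "i \<in> {..degree v}"
        have "hahn_abs c (coeff v i * \<beta> ^ i) \<le> 1 * max 1 (hahn_abs c \<beta>) ^ i"
          unfolding hahn_abs_mult[OF c] hahn_abs_power[OF c] using v(3) c
          by (intro mult_mono hahn_abs_tpoly_le_1 power_mono) auto
        also have "\<dots> \<le> B" unfolding B_def using i v(2) by (simp add: power_increasing)
        finally show "hahn_abs c (coeff v i * \<beta> ^ i) \<le> B" .
      qed (use B in auto)
    qed (use c B in auto)
    finally have "1 / (B * c ^ (Suc d * s')) \<le> hahn_abs c x"
      using B c by (simp add: field_simps)
    moreover have "\<kappa> / c ^ (D * (s + N)) \<le> 1 / (B * c ^ (Suc d * s'))"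
    proof -
      \<comment> \<open>The part of the exponent free of \<open>s\<close> and \<open>N\<close> sits
        in \<kappa>; the factor \<open>Suc m\<close> of \<open>D\<close> covers both
        \<open>s\<close> and \<open>m * N\<close>.\<close>
      have "Suc d * s' \<le> Suc d * (m * d) + D * (s + N)" by (simp add: s'_def D_def algebra_simps)
      then have "c ^ (Suc d * s') \<le> c ^ (Suc d * (m * d)) * c ^ (D * (s + N))"
        using c unfolding power_add[symmetric] by (intro power_increasing) auto
      then have "B * c ^ (Suc d * s') \<le> B * (c ^ (Suc d * (m * d)) * c ^ (D * (s + N)))"
        using B by (intro mult_left_mono) auto
      then have "1 / (B * (c ^ (Suc d * (m * d)) * c ^ (D * (s + N)))) \<le> 1 / (B * c ^ (Suc d * s'))"
        using B c by (intro divide_left_mono) auto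
      then show ?thesis by (simp add: \<kappa>_def mult.assoc)
    qed
    ultimately show ?thesis by linarith
  qed
  ultimately show ?thesis using that by blast
qed

section \<open>The operator \<open>\<tau>\<close>\<close>

lemma hahn_nth_tau: "Q > 0 \<Longrightarrow> hahn_nth (tau Q x) i = hahn_nth x i ^ Q"
  by transfer auto

lemma hahn_supp_tau: "Q > 0 \<Longrightarrow> hahn_supp (tau Q x) = hahn_supp x"
  by (simp add: hahn_supp_def hahn_nth_tau)

lemma tpoly_tau: "Q > 0 \<Longrightarrow> x \<in> tpoly s \<Longrightarrow> tau Q x \<in> tpoly s"
  by (simp add: tpoly_def hahn_supp_tau)

lemma tau_0 [simp]: "Q > 0 \<Longrightarrow> tau Q 0 = 0"
  by (rule hahn_eqI) (simp add: hahn_nth_tau)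

lemma tau_1 [simp]: "Q > 0 \<Longrightarrow> tau Q 1 = 1"
  by (rule hahn_eqI) (simp add: hahn_nth_tau hahn_nth_1)

lemma tau_eq_0_iff [simp]: "Q > 0 \<Longrightarrow> tau Q x = 0 \<longleftrightarrow> x = 0"
  by (metis hahn_eqI hahn_nth_0 hahn_nth_tau power_eq_0_iff)

lemma hahn_abs_tau [simp]: "Q > 0 \<Longrightarrow> hahn_abs c (tau Q x) = hahn_abs c x"
  by (simp add: hahn_abs_def hahn_ord_def hahn_nth_tau)

lemma tau_tau: "Q > 0 \<Longrightarrow> Q' > 0 \<Longrightarrow> tau Q (tau Q' x) = tau (Q * Q') x"
  by (rule hahn_eqI) (simp add: hahn_nth_tau mult.commute flip: power_mult)

lemma tau_1_left: "tau (Suc 0) x = x"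
  by (rule hahn_eqI) (simp add: hahn_nth_tau)

context
  fixes Q p k :: nat
  assumes p: "prime p" and Q: "Q = p ^ k" and char: "CHAR('c::field) = p"
begin

lemma Q_pos: "Q > 0"
  using p Q by (simp add: prime_gt_0_nat)

lemma power_Q_sum: "(\<Sum>i\<in>I. f i) ^ Q = (\<Sum>i\<in>I. f i ^ Q :: 'c)"
  using freshmans_dream_sum'[of Q k f I] p char Q by simp

lemma power_Q_add: "(x + y) ^ Q = x ^ Q + (y ^ Q :: 'c)"
  using freshmans_dream'[of Q k x y] p char Q by simp

lemma tau_add: "tau Q (x + y :: 'c hahn) = tau Q x + tau Q y"
  by (rule hahn_eqI) (simp add: hahn_nth_tau Q_pos power_Q_add)

text \<open>A coefficient of a product is a sum over pairs from the two supports. \<open>tau\<close>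
  leaves the supports alone, and the power map of exponent \<open>Q\<close>, additive in
  characteristic \<open>p\<close>, passes through the sum.\<close>

lemma tau_mult: "tau Q (x * y :: 'c hahn) = tau Q x * tau Q y"
proof (rule hahn_eqI)
  fix r
  show "hahn_nth (tau Q (x * y)) r = hahn_nth (tau Q x * tau Q y) r"
    by (simp add: hahn_nth_tau Q_pos hahn_nth_mult' hahn_supp_tau power_Q_sum case_prod_beta
        power_mult_distrib)
qed

lemma tau_sum: "tau Q (\<Sum>i\<in>I. f i :: 'c hahn) = (\<Sum>i\<in>I. tau Q (f i))"
  by (induction I rule: infinite_finite_induct) (auto simp: Q_pos tau_add)

lemma fps_nth_tau_fps: "fps_nth (tau_fps Q f) n = (if Q dvd n then tau Q (fps_nth f (n div Q)) else 0)"
  by (simp add: tau_fps_def)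

lemma tau_fps_add: "tau_fps Q (f + g :: 'c hahn fps) = tau_fps Q f + tau_fps Q g"
  by (rule fps_ext) (simp add: fps_nth_tau_fps tau_add)

lemma tau_fps_mult: "tau_fps Q (f * g :: 'c hahn fps) = tau_fps Q f * tau_fps Q g"
proof (rule fps_ext)
  fix n
  let ?F = "\<lambda>i. fps_nth (tau_fps Q f) i * fps_nth (tau_fps Q g) (n - i)"
  have rhs: "fps_nth (tau_fps Q f * tau_fps Q g) n = sum ?F {0..n}" by (simp add: fps_mult_nth)
  show "fps_nth (tau_fps Q (f * g)) n = fps_nth (tau_fps Q f * tau_fps Q g) n"
  proof (cases "Q dvd n")
    case True
    then obtain m where m: "n = Q * m" by blast
    \<comment> \<open>Only indices divisible by \<open>Q\<close> contribute to the
      convolution.\<close>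
    have "?F i = 0" if "i \<in> {0..n} - (\<lambda>i. Q * i) ` {0..m}" for i
    proof -
      have "\<not> Q dvd i"
      proof
        assume "Q dvd i"
        then obtain r where r: "i = Q * r" by blast
        then have "r \<le> m" using that m Q_pos by simp
        then show False using that r by auto
      qed
      then show ?thesis by (simp add: fps_nth_tau_fps)
    qed
    then have "sum ?F {0..n} = sum ?F ((\<lambda>i. Q * i) ` {0..m})"
      by (intro sum.mono_neutral_right) (auto simp: m)
    also have "\<dots> = (\<Sum>i=0..m. ?F (Q * i))"
      using Q_pos by (subst sum.reindex) (auto simp: inj_on_def)
    also have "\<dots> = (\<Sum>i=0..m. tau Q (fps_nth f i) * tau Q (fps_nth g (m - i)))"
    proof (intro sum.cong refl)
      fix i assume "i \<in> {0..m}"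
      have "n - Q * i = Q * (m - i)" by (simp add: m diff_mult_distrib2)
      then show "?F (Q * i) = tau Q (fps_nth f i) * tau Q (fps_nth g (m - i))"
        using Q_pos by (simp add: fps_nth_tau_fps)
    qed
    also have "\<dots> = fps_nth (tau_fps Q (f * g)) n"
      using Q_pos by (simp add: fps_nth_tau_fps m fps_mult_nth tau_sum tau_mult)
    finally show ?thesis by (simp add: rhs)
  next
    case False
    \<comment> \<open>If \<open>Q\<close> divided both \<open>i\<close> and \<open>n - i\<close>, it
      would divide \<open>n\<close>; hence one factor vanishes.\<close>
    then have "?F i = 0" if "i \<le> n" for i
      using that dvd_diffD[of Q n i] by (auto simp: fps_nth_tau_fps)
    then have "sum ?F {0..n} = 0" by (intro sum.neutral) auto
    then show ?thesis using False unfolding rhs by (simp add: fps_nth_tau_fps)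
  qed
qed

lemma tau_fps_const: "tau_fps Q (fps_const x :: 'c hahn fps) = fps_const (tau Q x)"
proof (rule fps_ext)
  fix n
  have "Q dvd n \<Longrightarrow> n div Q = 0 \<longleftrightarrow> n = 0" by (metis dvd_mult_div_cancel div_0 mult_0_right)
  then show "fps_nth (tau_fps Q (fps_const x)) n = fps_nth (fps_const (tau Q x)) n"
    by (auto simp: fps_nth_tau_fps Q_pos)
qed

lemma tau_fps_power: "tau_fps Q (f ^ n :: 'c hahn fps) = tau_fps Q f ^ n"
  using tau_fps_const[of 1] by (induction n) (auto simp: tau_fps_mult Q_pos)

lemma tau_fps_X: "tau_fps Q (fps_X :: 'c hahn fps) = fps_X ^ Q"
proof (rule fps_ext)
  fix n
  have "Q dvd n \<and> n div Q = 1 \<longleftrightarrow> n = Q"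
    using Q_pos by (metis div_self dvd_mult_div_cancel dvd_refl mult.right_neutral not_gr_zero)
  then show "fps_nth (tau_fps Q fps_X) n = fps_nth (fps_X ^ Q :: 'c hahn fps) n"
    by (auto simp: fps_nth_tau_fps Q_pos fps_X_power_nth)
qed

lemma tau_fps_sum: "tau_fps Q (\<Sum>i\<in>I. f i :: 'c hahn fps) = (\<Sum>i\<in>I. tau_fps Q (f i))"
  using tau_fps_const[of 0] by (induction I rule: infinite_finite_induct) (auto simp: tau_fps_add Q_pos)

end

lemma tau_fps_tau_fps:
  assumes "Q > 0" "Q' > 0"
  shows "tau_fps Q (tau_fps Q' f) = tau_fps (Q * Q') f"
proof (rule fps_ext)
  fix n
  show "fps_nth (tau_fps Q (tau_fps Q' f)) n = fps_nth (tau_fps (Q * Q') f) n"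
  proof (cases "Q dvd n")
    case True
    then obtain m where "n = Q * m" by blast
    then show ?thesis using assms by (simp add: tau_fps_def tau_tau)
  next
    case False
    then show ?thesis by (auto simp: tau_fps_def dvd_mult_left)
  qed
qed

lemma tau_fps_1_left: "tau_fps (Suc 0) f = f"
  by (rule fps_ext) (simp add: tau_fps_def tau_1_left)

lemma tau_fps_funpow:
  assumes "q > 0"
  shows "(tau_fps q ^^ n) f = tau_fps (q ^ n) f"
  using assms by (induction n) (auto simp: tau_fps_tau_fps tau_fps_1_left)

section \<open>The characteristic of the constants\<close>

lemma CARD_power_imp_CHAR:
  assumes "prime p" "CARD('k::{field, finite}) = p ^ e"
  shows "(of_nat p :: 'k) = 0"
proof -
  \<comment> \<open>Translation by 1 permutes the finite field, so it leaves the sum of all elements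
    unchanged.\<close>
  have "(\<Sum>x\<in>(UNIV :: 'k set). x) = (\<Sum>x\<in>(UNIV :: 'k set). x + 1)"
    by (rule sum.reindex_bij_witness[of _ "\<lambda>x. x + 1" "\<lambda>x. x - 1"]) auto
  then have "of_nat (CARD('k)) = (0 :: 'k)" by (simp add: sum.distrib)
  then show ?thesis using assms by simp
qed

lemma CHAR_embedded:
  fixes j :: "'k::{field, finite} fls \<Rightarrow> 'c::field"
  assumes "prime p" "CARD('k) = p ^ e" "field_embedding j"
  shows "CHAR('c) = p"
proof -
  have j: "j (x + y) = j x + j y" "j 1 = 1" for x y
    using assms(3) by (auto simp: field_embedding_def)
  have j0: "j 0 = 0" using j(1)[of 0 0] by (metis add_0_right add_left_cancel)
  have "j (of_nat n) = of_nat n" for n by (induction n) (auto simp: j j0)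
  moreover have "(of_nat p :: 'k fls) = fls_const (of_nat p)" by (simp add: fls_of_nat)
  ultimately have "(of_nat p :: 'c) = 0"
    using CARD_power_imp_CHAR[OF assms(1,2)] j0 by (metis fls_const_0)
  then have "CHAR('c) dvd p" by (simp add: of_nat_eq_0_iff_char_dvd)
  then show ?thesis using assms(1) CHAR_not_1[where ?'a = 'c] by (auto simp: prime_nat_iff)
qed

section \<open>Values of power series\<close>

text \<open>Finiteness of the Gauss norm for radius \<open>r\<close>.\<close>

definition bounded_coeffs :: "real \<Rightarrow> real \<Rightarrow> 'c::field hahn fps \<Rightarrow> bool" where
  "bounded_coeffs c r g \<longleftrightarrow> (\<exists>C. \<forall>i. hahn_abs c (fps_nth g i) * r ^ i \<le> C)"

text \<open>The value \<open>s\<close> of \<open>g\<close> at \<open>\<alpha>\<close> is the remainder of the division by \<open>X - \<alpha>\<close>, which makes its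
  compatibility with sums and products immediate. The quotient is required to converge in a
  disc which is larger than \<open>|\<alpha>|\<close>, of radius the square root of \<open>|\<alpha>|\<close>.\<close>

definition has_value :: "real \<Rightarrow> 'c::field hahn \<Rightarrow> 'c hahn fps \<Rightarrow> 'c hahn \<Rightarrow> bool" where
  "has_value c \<alpha> g s \<longleftrightarrow> (\<exists>h. bounded_coeffs c (sqrt (hahn_abs c \<alpha>)) h \<and>
     g = fps_const s + (fps_X - fps_const \<alpha>) * h)"

context
  fixes c :: real
  assumes c: "c > 1"
begin

lemma bounded_coeffsE:
  assumes "bounded_coeffs c r g"
  obtains C where "C > 0" "\<And>i. hahn_abs c (fps_nth g i) * r ^ i \<le> C"
proof -
  obtain C where "\<forall>i. hahn_abs c (fps_nth g i) * r ^ i \<le> C"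
    using assms unfolding bounded_coeffs_def by blast
  then show ?thesis using that[of "max C 1"] by (simp add: le_max_iff_disj)
qed

lemma bounded_coeffs_add:
  assumes "0 \<le> r" "bounded_coeffs c r g" "bounded_coeffs c r h"
  shows "bounded_coeffs c r (g + h)"
proof -
  obtain C where C: "\<And>i. hahn_abs c (fps_nth g i) * r ^ i \<le> C"
    using assms unfolding bounded_coeffs_def by blast
  obtain D where D: "\<And>i. hahn_abs c (fps_nth h i) * r ^ i \<le> D"
    using assms unfolding bounded_coeffs_def by blast
  have "hahn_abs c (fps_nth (g + h) i) * r ^ i \<le> max C D" for i
  proof -
    have "hahn_abs c (fps_nth (g + h) i) * r ^ i
        \<le> max (hahn_abs c (fps_nth g i)) (hahn_abs c (fps_nth h i)) * r ^ i"
      using hahn_abs_add_le_max[OF c] assms(1) by (intro mult_right_mono) auto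
    also have "\<dots> \<le> max C D" using C[of i] D[of i] by (auto simp: max_def)
    finally show ?thesis .
  qed
  then show ?thesis unfolding bounded_coeffs_def by blast
qed

text \<open>By the ultrametric inequality a convolution is bounded by its largest term, so the
  radius does not shrink.\<close>

lemma bounded_coeffs_mult:
  assumes "0 < r" "bounded_coeffs c r g" "bounded_coeffs c r h"
  shows "bounded_coeffs c r (g * h)"
proof -
  obtain C where C: "C > 0" "\<And>i. hahn_abs c (fps_nth g i) * r ^ i \<le> C"
    using bounded_coeffsE[OF assms(2)] by blast
  obtain D where D: "D > 0" "\<And>i. hahn_abs c (fps_nth h i) * r ^ i \<le> D"
    using bounded_coeffsE[OF assms(3)] by blast
  have "hahn_abs c (fps_nth (g * h) n) * r ^ n \<le> C * D" for n
  proof -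
    have "hahn_abs c (fps_nth (g * h) n) \<le> C * D / r ^ n"
      unfolding fps_mult_nth
    proof (intro hahn_abs_sum_le[OF c])
      fix i assume "i \<in> {0..n}"
      then have "r ^ n = r ^ i * r ^ (n - i)" by (simp flip: power_add)
      then have "hahn_abs c (fps_nth g i * fps_nth h (n - i)) * r ^ n =
          (hahn_abs c (fps_nth g i) * r ^ i) * (hahn_abs c (fps_nth h (n - i)) * r ^ (n - i))"
        by (simp add: hahn_abs_mult[OF c] ac_simps)
      also have "\<dots> \<le> C * D"
        using C D c assms(1) by (intro mult_mono) auto
      finally show "hahn_abs c (fps_nth g i * fps_nth h (n - i)) \<le> C * D / r ^ n"
        using assms(1) by (simp add: pos_le_divide_eq)
    qed (use C D assms in auto)
    then show ?thesis using assms(1) by (simp add: pos_le_divide_eq)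
  qed
  then show ?thesis unfolding bounded_coeffs_def by blast
qed

lemma bounded_coeffs_const: "bounded_coeffs c r (fps_const x)"
  unfolding bounded_coeffs_def by (rule exI[of _ "hahn_abs c x"]) (auto simp: c)

lemma bounded_coeffs_X: "bounded_coeffs c r fps_X"
  unfolding bounded_coeffs_def by (rule exI[of _ "max 0 r"]) (auto simp: c fps_X_nth)

lemma bounded_coeffs_power: "0 < r \<Longrightarrow> bounded_coeffs c r g \<Longrightarrow> bounded_coeffs c r (g ^ n)"
  using bounded_coeffs_const[of r 1] by (induction n) (auto intro: bounded_coeffs_mult)

lemma bounded_coeffs_sum:
  "0 \<le> r \<Longrightarrow> (\<And>i. i \<in> I \<Longrightarrow> bounded_coeffs c r (f i)) \<Longrightarrow> bounded_coeffs c r (sum f I)"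
  using bounded_coeffs_const[of r 0]
  by (induction I rule: infinite_finite_induct) (auto intro: bounded_coeffs_add)

section \<open>Evaluation at \<alpha>\<close>

context
  fixes \<alpha> :: "'c::field hahn"
  assumes \<alpha>: "0 < hahn_abs c \<alpha>" "hahn_abs c \<alpha> < 1"
begin

text \<open>Since \<alpha> has absolute value \<open>r ^ 2\<close>, a coefficient bound for radius
  \<open>r\<close> absorbs half of the decay of \<open>\<alpha> ^ n\<close> and leaves the geometric
  factor \<open>r ^ n\<close>.\<close>

private definition r where "r = sqrt (hahn_abs c \<alpha>)"

private lemma r: "0 < r" "r < 1" "hahn_abs c \<alpha> = r ^ 2"
  using \<alpha> by (auto simp: r_def)

private lemma has_value_iff:
  "has_value c \<alpha> g s \<longleftrightarrow> (\<exists>h. bounded_coeffs c r h \<and> g = fps_const s + (fps_X - fps_const \<alpha>) * h)"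
  by (simp add: has_value_def r_def)

lemma bounded_coeffs_has_value:
  assumes "has_value c \<alpha> g s"
  shows "bounded_coeffs c (sqrt (hahn_abs c \<alpha>)) g"
proof -
  obtain h where h: "bounded_coeffs c r h" "g = fps_const s + (fps_X - fps_const \<alpha>) * h"
    using assms has_value_iff by blast
  have "bounded_coeffs c r (fps_const s + (fps_X + fps_const (- \<alpha>)) * h)"
    using r h by (intro bounded_coeffs_add bounded_coeffs_mult bounded_coeffs_const bounded_coeffs_X) auto
  moreover have "fps_X + fps_const (- \<alpha>) = fps_X - fps_const \<alpha>"
    by (simp flip: fps_const_neg)
  ultimately show ?thesis using h(2) by (simp add: r_def)
qed

lemma has_value_const: "has_value c \<alpha> (fps_const s) s"
  unfolding has_value_def using bounded_coeffs_const[of _ 0] by (intro exI[of _ 0]) simp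

lemma has_value_X: "has_value c \<alpha> fps_X \<alpha>"
  unfolding has_value_def using bounded_coeffs_const[of _ 1] by (intro exI[of _ 1]) simp

lemma has_value_add:
  assumes "has_value c \<alpha> g s" "has_value c \<alpha> g' s'"
  shows "has_value c \<alpha> (g + g') (s + s')"
proof -
  obtain h where h: "bounded_coeffs c r h" "g = fps_const s + (fps_X - fps_const \<alpha>) * h"
    using assms(1) has_value_iff by blast
  obtain h' where h': "bounded_coeffs c r h'" "g' = fps_const s' + (fps_X - fps_const \<alpha>) * h'"
    using assms(2) has_value_iff by blast
  have "g + g' = fps_const (s + s') + (fps_X - fps_const \<alpha>) * (h + h')"
    unfolding h(2) h'(2) by (simp add: algebra_simps flip: fps_const_add)
  then show ?thesis unfolding has_value_iff
    using bounded_coeffs_add[of r h h'] h h' r by auto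
qed

text \<open>The new quotient by X - \<alpha> is \<open>fps_const s * h' + h * g'\<close>; it is
  bounded because a series with a value is itself bounded for radius \<open>r\<close>.\<close>

lemma has_value_mult:
  assumes "has_value c \<alpha> g s" "has_value c \<alpha> g' s'"
  shows "has_value c \<alpha> (g * g') (s * s')"
proof -
  obtain h where h: "bounded_coeffs c r h" "g = fps_const s + (fps_X - fps_const \<alpha>) * h"
    using assms(1) has_value_iff by blast
  obtain h' where h': "bounded_coeffs c r h'" "g' = fps_const s' + (fps_X - fps_const \<alpha>) * h'"
    using assms(2) has_value_iff by blast
  have "g * g' = fps_const (s * s') + (fps_X - fps_const \<alpha>) * (fps_const s * h' + h * g')"
    unfolding h(2) h'(2) fps_const_mult[symmetric] by (simp only: algebra_simps)
  moreover have "bounded_coeffs c r (fps_const s * h' + h * g')"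
    using bounded_coeffs_has_value[OF assms(2)] h(1) h'(1) r
    by (intro bounded_coeffs_add bounded_coeffs_mult bounded_coeffs_const) (simp_all flip: r_def)
  ultimately show ?thesis using has_value_iff by metis
qed

lemma has_value_power: "has_value c \<alpha> g s \<Longrightarrow> has_value c \<alpha> (g ^ n) (s ^ n)"
  using has_value_const[of 1] by (induction n) (auto intro: has_value_mult)

lemma has_value_sum:
  "(\<And>i. i \<in> I \<Longrightarrow> has_value c \<alpha> (f i) (s i)) \<Longrightarrow> has_value c \<alpha> (sum f I) (sum s I)"
  using has_value_const[of 0]
  by (induction I rule: infinite_finite_induct) (auto intro: has_value_add)

section \<open>Values as limits of partial sums\<close>

lemma has_value_imp_tendsto:
  assumes "has_value c \<alpha> g s"
  shows "(\<lambda>n. hahn_abs c ((\<Sum>i<n. fps_nth g i * \<alpha> ^ i) - s)) \<longlonglongrightarrow> 0"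
proof -
  obtain h where h: "bounded_coeffs c r h" "g = fps_const s + (fps_X - fps_const \<alpha>) * h"
    using assms has_value_iff by blast
  obtain C where C: "C > 0" "\<And>i. hahn_abs c (fps_nth h i) * r ^ i \<le> C"
    using bounded_coeffsE[OF h(1)] by blast
  have nth: "fps_nth g n = (if n = 0 then s else fps_nth h (n - 1)) - \<alpha> * fps_nth h n" for n
    unfolding h(2) by (simp add: left_diff_distrib)
  \<comment> \<open>The partial sums telescope, leaving one term of the quotient.\<close>
  have sum: "(\<Sum>i<Suc n. fps_nth g i * \<alpha> ^ i) - s = - (fps_nth h n * \<alpha> ^ Suc n)" for n
  proof (induction n)
    case (Suc n)
    show ?case using Suc by (subst sum.lessThan_Suc) (simp add: nth algebra_simps)
  qed (simp add: nth)
  let ?e = "\<lambda>n. hahn_abs c ((\<Sum>i<Suc n. fps_nth g i * \<alpha> ^ i) - s)"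
  have "norm (?e n) \<le> C * r ^ n" for n
  proof -
    have "hahn_abs c ((\<Sum>i<Suc n. fps_nth g i * \<alpha> ^ i) - s) = hahn_abs c (fps_nth h n) * (r ^ 2) ^ Suc n"
      unfolding sum by (simp add: c hahn_abs_mult[OF c] hahn_abs_power[OF c] r)
    also have "\<dots> = (hahn_abs c (fps_nth h n) * r ^ n) * (r ^ n * r ^ 2)"
      by (simp only: power_mult_distrib power2_eq_square power_Suc mult_ac)
    also have "\<dots> \<le> C * (r ^ n * r ^ 2)" using C r by (intro mult_right_mono) auto
    also have "\<dots> \<le> C * (r ^ n * 1)" using C r by (intro mult_left_mono power_le_one) auto
    finally show ?thesis
      by (simp only: real_norm_def abs_of_nonneg[OF hahn_abs_nonneg[OF c]] mult_1_right)
  qed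
  then have "\<forall>\<^sub>F n in sequentially. norm (?e n) \<le> C * r ^ n"
    by (intro always_eventually allI)
  moreover have "(\<lambda>n. C * r ^ n) \<longlonglongrightarrow> 0"
    using r by (auto intro!: tendsto_mult_right_zero LIMSEQ_power_zero)
  ultimately have "?e \<longlonglongrightarrow> 0" by (rule Lim_null_comparison)
  then show ?thesis by (rule LIMSEQ_imp_Suc)
qed

text \<open>Uniqueness of limits. It allows two evaluations of one series to be compared, which is
  how the functional equation is specialised.\<close>

lemma has_value_unique:
  assumes "has_value c \<alpha> g s" "has_value c \<alpha> g s'"
  shows "s = s'"
proof (rule ccontr)
  let ?S = "\<lambda>n. \<Sum>i<n. fps_nth g i * \<alpha> ^ i"
  assume "s \<noteq> s'"
  then have pos: "hahn_abs c (s - s') > 0" using c by simp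
  have "\<forall>\<^sub>F n in sequentially. hahn_abs c (?S n - s) < hahn_abs c (s - s')"
    "\<forall>\<^sub>F n in sequentially. hahn_abs c (?S n - s') < hahn_abs c (s - s')"
    using has_value_imp_tendsto[OF assms(1)] has_value_imp_tendsto[OF assms(2)] pos
    by (auto elim: order_tendstoD(2))
  then have "\<forall>\<^sub>F n in sequentially. False"
  proof eventually_elim
    case (elim n)
    then show False
      using hahn_abs_add_le_max[OF c, of "- (?S n - s)" "?S n - s'"] hahn_abs_minus[OF c, of "?S n - s"]
      by simp
  qed
  then show False by simp
qed

lemma partial_sum_diff_le:
  assumes C: "\<And>i. hahn_abs c (fps_nth g i) * r ^ i \<le> C" and "C > 0" "n \<le> m"
  shows "hahn_abs c ((\<Sum>i<m. fps_nth g i * \<alpha> ^ i) - (\<Sum>i<n. fps_nth g i * \<alpha> ^ i)) \<le> C * r ^ n"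
proof -
  have "(\<Sum>i<m. fps_nth g i * \<alpha> ^ i) - (\<Sum>i<n. fps_nth g i * \<alpha> ^ i) = (\<Sum>i\<in>{..<m} - {..<n}. fps_nth g i * \<alpha> ^ i)"
    using assms(3) by (subst sum_diff) auto
  also have "hahn_abs c \<dots> \<le> C * r ^ n"
  proof (intro hahn_abs_sum_le[OF c])
    fix i assume i: "i \<in> {..<m} - {..<n}"
    have "hahn_abs c (fps_nth g i * \<alpha> ^ i) = (hahn_abs c (fps_nth g i) * r ^ i) * r ^ i"
      by (simp add: hahn_abs_mult[OF c] hahn_abs_power[OF c] r power2_eq_square power_mult_distrib)
    also have "\<dots> \<le> C * r ^ i" using C r by (intro mult_right_mono) auto
    also have "\<dots> \<le> C * r ^ n" using i r \<open>C > 0\<close> by (intro mult_left_mono power_decreasing) auto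
    finally show "hahn_abs c (fps_nth g i * \<alpha> ^ i) \<le> C * r ^ n" .
  qed (use r \<open>C > 0\<close> in auto)
  finally show ?thesis .
qed

lemma has_valueI:
  assumes "bounded_coeffs c (sqrt (hahn_abs c \<alpha>)) g"
    and "(\<lambda>n. hahn_abs c ((\<Sum>i<n. fps_nth g i * \<alpha> ^ i) - s)) \<longlonglongrightarrow> 0"
  shows "has_value c \<alpha> g s"
proof -
  let ?S = "\<lambda>n. \<Sum>i<n. fps_nth g i * \<alpha> ^ i"
  obtain C where C: "C > 0" "\<And>i. hahn_abs c (fps_nth g i) * r ^ i \<le> C"
    using bounded_coeffsE[OF assms(1)] by (auto simp: r_def)
  have \<alpha>0: "\<alpha> \<noteq> 0" using \<alpha> c by auto
  \<comment> \<open>Synthetic division: the quotient by X - \<alpha> has the tails of the series at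
    \<alpha> as coefficients, divided by powers of \<alpha>.\<close>
  define h where "h = Abs_fps (\<lambda>i. (s - ?S (Suc i)) / \<alpha> ^ Suc i)"
  have tail: "hahn_abs c (s - ?S n) \<le> C * r ^ n" for n
  proof -
    have "C * r ^ n > 0" using C r by simp
    then have "\<forall>\<^sub>F m in sequentially. hahn_abs c (?S m - s) < C * r ^ n"
      using assms(2) by (auto elim: order_tendstoD(2))
    then have "\<forall>\<^sub>F m in sequentially. hahn_abs c (?S m - s) < C * r ^ n \<and> n \<le> m"
      using eventually_ge_at_top[of n] by eventually_elim auto
    then obtain m where m: "hahn_abs c (?S m - s) < C * r ^ n" "n \<le> m"
      by (metis (mono_tags, lifting) eventually_happens trivial_limit_sequentially)
    \<comment> \<open>A late partial sum \<open>?S m\<close> stands in for the limit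
      \<open>s\<close>.\<close>
    have "hahn_abs c ((?S m - ?S n) - (?S m - s)) \<le> C * r ^ n"
      by (rule hahn_abs_diff_le[OF c]) (use partial_sum_diff_le[OF C(2,1) m(2)] m(1) in auto)
    then show ?thesis by simp
  qed
  \<comment> \<open>A tail of size at most \<open>C * r ^ Suc i\<close>, divided by a power of size
    \<open>r ^ (2 * Suc i)\<close>, is at most \<open>C / r ^ Suc i\<close>.\<close>
  have "hahn_abs c (fps_nth h i) * r ^ i \<le> C / r" for i
  proof -
    have "hahn_abs c (fps_nth h i) * hahn_abs c (\<alpha> ^ Suc i) = hahn_abs c (s - ?S (Suc i))"
      using \<alpha>0 by (simp add: h_def flip: hahn_abs_mult[OF c])
    then have "hahn_abs c (fps_nth h i) * (r ^ 2) ^ Suc i \<le> C * r ^ Suc i"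
      using tail[of "Suc i"] by (simp only: hahn_abs_power[OF c] r(3))
    then have "(hahn_abs c (fps_nth h i) * r ^ i * r) * r ^ Suc i \<le> C * r ^ Suc i"
      by (simp add: power_mult_distrib power2_eq_square ac_simps)
    then have "hahn_abs c (fps_nth h i) * r ^ i * r \<le> C"
      using r by (simp add: mult_le_cancel_right)
    then show ?thesis using r by (simp add: pos_le_divide_eq)
  qed
  then have "bounded_coeffs c r h" unfolding bounded_coeffs_def by blast
  moreover have "g = fps_const s + (fps_X - fps_const \<alpha>) * h"
  proof (rule fps_ext)
    fix n
    show "fps_nth g n = fps_nth (fps_const s + (fps_X - fps_const \<alpha>) * h) n"
    proof (cases n)
      case 0
      then show ?thesis using \<alpha>0 by (simp add: h_def left_diff_distrib)
    next
      case (Suc k)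
      have "\<alpha> * fps_nth h n = (s - ?S (Suc n)) / \<alpha> ^ n"
        using \<alpha>0 by (simp add: h_def)
      moreover have "?S (Suc n) = ?S n + fps_nth g n * \<alpha> ^ n" by simp
      ultimately have "\<alpha> * fps_nth h n = (s - ?S n) / \<alpha> ^ n - fps_nth g n"
        using \<alpha>0 by (simp add: field_simps del: sum.lessThan_Suc)
      moreover have "fps_nth h k = (s - ?S n) / \<alpha> ^ n" by (simp add: h_def Suc)
      ultimately show ?thesis by (simp add: left_diff_distrib Suc)
    qed
  qed
  ultimately show ?thesis unfolding has_value_iff by blast
qed

text \<open>Differences of partial sums decay like \<open>r ^ n\<close>, so completeness of
  \<open>L\<close> supplies a sum, which is then also the value in the sense of division by X -
  \<alpha>.\<close>

lemma bounded_imp_sums_to: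
  assumes "is_subfield L" "Metric_space.mcomplete L (\<lambda>x y. hahn_abs c (x - y))"
    and "\<And>i. fps_nth g i \<in> L" "\<alpha> \<in> L"
    and "bounded_coeffs c (sqrt (hahn_abs c \<alpha>)) g"
  shows "\<exists>s. fps_sums_to (hahn_abs c) L g \<alpha> s \<and> has_value c \<alpha> g s"
proof -
  let ?S = "\<lambda>n. \<Sum>i<n. fps_nth g i * \<alpha> ^ i"
  interpret Metric_space L "\<lambda>x y. hahn_abs c (x - y)" by (rule Metric_space_hahn[OF c])
  obtain C where C: "C > 0" "\<And>i. hahn_abs c (fps_nth g i) * r ^ i \<le> C"
    using bounded_coeffsE[OF assms(5)] by (auto simp: r_def)
  have S: "?S n \<in> L" for n
    by (intro is_subfield_sum is_subfieldD is_subfield_power assms)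
  have "MCauchy ?S" unfolding MCauchy_def
  proof (intro conjI allI impI)
    fix \<epsilon> :: real assume \<epsilon>: "\<epsilon> > 0"
    have "(\<lambda>n. C * r ^ n) \<longlonglongrightarrow> 0"
      using r by (auto intro!: tendsto_mult_right_zero LIMSEQ_power_zero)
    then have "\<forall>\<^sub>F n in sequentially. C * r ^ n < \<epsilon>" using \<epsilon> by (rule order_tendstoD)
    then obtain N where N: "C * r ^ N < \<epsilon>" by (auto simp: eventually_sequentially)
    have "hahn_abs c (?S n - ?S n') < \<epsilon>" if "N \<le> n" "N \<le> n'" for n n'
    proof -
      have "hahn_abs c ((?S n - ?S N) - (?S n' - ?S N)) \<le> C * r ^ N"
        by (intro hahn_abs_diff_le[OF c, of "?S n - ?S N"] partial_sum_diff_le C that)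
      then show ?thesis using N by simp
    qed
    then show "\<exists>N. \<forall>n n'. N \<le> n \<longrightarrow> N \<le> n' \<longrightarrow> hahn_abs c (?S n - ?S n') < \<epsilon>" by blast
  qed (use S in auto)
  then obtain s where s: "limitin mtopology ?S s sequentially"
    using assms(2) unfolding mcomplete_def by blast
  then have "(\<lambda>n. hahn_abs c (?S n - s)) \<longlonglongrightarrow> 0"
    unfolding limitin_metric_dist_null by blast
  then have "has_value c \<alpha> g s" using assms(5) by (intro has_valueI)
  then show ?thesis using s by (auto simp: fps_sums_to_def)
qed

text \<open>Terms are differences of successive partial sums, so convergence bounds all but finitely
  many of them by 1; a finite sum takes care of the rest.\<close>

lemma sums_to_imp_bounded:
  assumes "fps_sums_to (hahn_abs c) L g \<alpha> s"
  shows "bounded_coeffs c (hahn_abs c \<alpha>) g"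
proof -
  let ?S = "\<lambda>n. \<Sum>i<n. fps_nth g i * \<alpha> ^ i"
  let ?b = "\<lambda>i. hahn_abs c (fps_nth g i) * hahn_abs c \<alpha> ^ i"
  interpret Metric_space L "\<lambda>x y. hahn_abs c (x - y)" by (rule Metric_space_hahn[OF c])
  have "(\<lambda>n. hahn_abs c (?S n - s)) \<longlonglongrightarrow> 0"
    using assms unfolding fps_sums_to_def limitin_metric_dist_null by blast
  then have "\<forall>\<^sub>F n in sequentially. hahn_abs c (?S n - s) < 1" by (rule order_tendstoD) simp
  then obtain N where N: "\<And>n. n \<ge> N \<Longrightarrow> hahn_abs c (?S n - s) < 1"
    by (auto simp: eventually_sequentially)
  have "?b n \<le> 1 + (\<Sum>i<N. ?b i)" for n
  proof (cases "n < N")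
    case True
    then have "?b n \<le> (\<Sum>i<N. ?b i)" using c by (intro member_le_sum) auto
    then show ?thesis by simp
  next
    case False
    then have "hahn_abs c (?S n - s) \<le> 1" "hahn_abs c (?S (Suc n) - s) \<le> 1"
      using N[of n] N[of "Suc n"] by (simp_all del: sum.lessThan_Suc)
    from hahn_abs_diff_le[OF c this(2,1)] have "hahn_abs c ((?S (Suc n) - s) - (?S n - s)) \<le> 1" .
    then have "?b n \<le> 1" by (simp add: hahn_abs_mult[OF c] hahn_abs_power[OF c])
    moreover have "0 \<le> (\<Sum>i<N. ?b i)" using c by (intro sum_nonneg) auto
    ultimately show ?thesis by simp
  qed
  then show ?thesis unfolding bounded_coeffs_def by blast
qed

text \<open>The coefficient of index \<open>m\<close> moves to \<open>Q * m\<close>, and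
  \<open>r ^ (Q * m) \<le> r ^ (2 * m)\<close>. A bound for the radius
  \<open>hahn_abs c \<alpha>\<close> thus becomes one for the larger radius \<open>r\<close>, as
  evaluation demands.\<close>

lemma bounded_coeffs_tau:
  assumes "bounded_coeffs c (hahn_abs c \<alpha>) g" "Q \<ge> 2"
  shows "bounded_coeffs c (sqrt (hahn_abs c \<alpha>)) (tau_fps Q g)"
proof -
  obtain C where C: "C > 0" "\<And>i. hahn_abs c (fps_nth g i) * hahn_abs c \<alpha> ^ i \<le> C"
    using bounded_coeffsE[OF assms(1)] by blast
  have "hahn_abs c (fps_nth (tau_fps Q g) n) * r ^ n \<le> C" for n
  proof (cases "Q dvd n")
    case True
    then obtain m where m: "n = Q * m" by blast
    have "hahn_abs c (fps_nth (tau_fps Q g) n) * r ^ n = hahn_abs c (fps_nth g m) * r ^ (Q * m)"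
      using assms(2) by (simp add: tau_fps_def m)
    also have "\<dots> \<le> hahn_abs c (fps_nth g m) * r ^ (2 * m)"
      using r assms(2) c by (intro mult_left_mono power_decreasing) auto
    also have "\<dots> \<le> C" using C(2)[of m] by (simp add: r power_mult)
    finally show ?thesis .
  next
    case False
    then show ?thesis using C by (simp add: tau_fps_def hahn_abs_def)
  qed
  then show ?thesis unfolding bounded_coeffs_def r_def by blast
qed

text \<open>For large \<open>Q\<close> the lowest term dominates.\<close>

lemma hahn_abs_value_tau:
  assumes "bounded_coeffs c (hahn_abs c \<alpha>) g" "g \<noteq> 0"
  shows "\<exists>Q0. \<forall>Q\<ge>Q0. \<forall>\<sigma>. has_value c \<alpha> (tau_fps Q g) \<sigma> \<longrightarrow>
     hahn_abs c \<sigma> = hahn_abs c (fps_nth g (subdegree g)) * hahn_abs c \<alpha> ^ (Q * subdegree g)"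
proof -
  define \<rho> where "\<rho> = hahn_abs c \<alpha>"
  define \<nu> where "\<nu> = subdegree g"
  have \<rho>: "0 < \<rho>" "\<rho> < 1" using \<alpha> by (auto simp: \<rho>_def)
  obtain C where C: "C > 0" "\<And>i. hahn_abs c (fps_nth g i) * \<rho> ^ i \<le> C"
    using bounded_coeffsE[OF assms(1)] by (auto simp: \<rho>_def)
  have lead: "0 < hahn_abs c (fps_nth g \<nu>)" using assms(2) c by (simp add: \<nu>_def)
  \<comment> \<open>A gain of \<open>\<rho> ^ k\<close> brings the coefficient bound
    \<open>C\<close> below the lowest coefficient.\<close>
  then obtain k where "\<rho> ^ k < hahn_abs c (fps_nth g \<nu>) / C"
    using real_arch_pow_inv[OF _ \<rho>(2)] C by (meson divide_pos_pos)
  then have k: "C * \<rho> ^ k < hahn_abs c (fps_nth g \<nu>)" using C by (simp add: field_simps)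
  have "hahn_abs c \<sigma> = hahn_abs c (fps_nth g \<nu>) * \<rho> ^ (Q * \<nu>)"
    if Q: "Q \<ge> Suc \<nu> + k" and \<sigma>: "has_value c \<alpha> (tau_fps Q g) \<sigma>" for Q \<sigma>
  proof -
    let ?S = "\<lambda>n. \<Sum>i<n. fps_nth (tau_fps Q g) i * \<alpha> ^ i"
    \<comment> \<open>\<open>T\<close> is the size of the lowest term and \<open>B\<close> bounds
      the others: for \<open>i \<ge> Suc \<nu>\<close> one factor \<open>\<rho> ^ i\<close> of
      \<open>\<rho> ^ (Q * i)\<close> is spent on the coefficient, and \<open>(Q - 1) * i\<close>
      powers remain.\<close>
    define T where "T = hahn_abs c (fps_nth g \<nu>) * \<rho> ^ (Q * \<nu>)"
    define B where "B = C * \<rho> ^ ((Q - 1) * Suc \<nu>)"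
    have Q0: "Q > 0" using Q by simp
    have "T > 0" using lead \<rho> by (simp add: T_def)
    \<comment> \<open>The lower bound on \<open>Q\<close> was chosen for this: the right side is
      \<open>Q * \<nu> + (Q - Suc \<nu>)\<close>.\<close>
    have "Q * \<nu> + k \<le> (Q - 1) * Suc \<nu>" using Q by (cases Q) (auto simp: algebra_simps)
    then have "B \<le> C * \<rho> ^ (Q * \<nu> + k)"
      unfolding B_def using C \<rho> by (intro mult_left_mono power_decreasing) auto
    also have "\<dots> < T" using k \<rho> by (simp add: T_def power_add)
    finally have "B < T" .
    have lead_term: "hahn_abs c (fps_nth (tau_fps Q g) (Q * \<nu>) * \<alpha> ^ (Q * \<nu>)) = T"
      using Q0 by (simp add: tau_fps_def hahn_abs_mult[OF c] hahn_abs_power[OF c] T_def \<rho>_def)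
    have other: "hahn_abs c (fps_nth (tau_fps Q g) n * \<alpha> ^ n) \<le> B" if "n \<noteq> Q * \<nu>" for n
    proof (cases "Q dvd n")
      case True
      then obtain i where i: "n = Q * i" by blast
      have *: "hahn_abs c (fps_nth (tau_fps Q g) n * \<alpha> ^ n) = hahn_abs c (fps_nth g i) * \<rho> ^ (Q * i)"
        using Q0 by (simp add: tau_fps_def i hahn_abs_mult[OF c] hahn_abs_power[OF c] \<rho>_def)
      show ?thesis
      proof (cases "i < \<nu>")
        case True
        then have "fps_nth g i = 0" unfolding \<nu>_def by (rule nth_less_subdegree_zero)
        then show ?thesis using C \<rho> unfolding * by (simp add: hahn_abs_def B_def)
      next
        case False
        then have "Suc \<nu> \<le> i" using that i by (metis Suc_leI linorder_neqE_nat)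
        have "Q * i = i + (Q - 1) * i" using Q0 by (cases Q) auto
        then have "hahn_abs c (fps_nth g i) * \<rho> ^ (Q * i) = (hahn_abs c (fps_nth g i) * \<rho> ^ i) * \<rho> ^ ((Q - 1) * i)"
          by (simp add: power_add)
        also have "\<dots> \<le> C * \<rho> ^ ((Q - 1) * i)" using C \<rho> by (intro mult_right_mono) auto
        also have "\<dots> \<le> B" unfolding B_def
          using C \<rho> \<open>Suc \<nu> \<le> i\<close> by (intro mult_left_mono power_decreasing mult_le_mono2) auto
        finally show ?thesis unfolding * .
      qed
    next
      case False
      then show ?thesis using C \<rho> by (simp add: tau_fps_def hahn_abs_def B_def)
    qed
    \<comment> \<open>The partial sum is taken long enough to contain the lowest term and to differ
      from \<sigma> by less than \<open>T\<close>; then both have size \<open>T\<close>.\<close>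
    have "\<forall>\<^sub>F n in sequentially. hahn_abs c (?S n - \<sigma>) < T"
      using has_value_imp_tendsto[OF \<sigma>] \<open>T > 0\<close> by (rule order_tendstoD)
    then have "\<forall>\<^sub>F n in sequentially. hahn_abs c (?S n - \<sigma>) < T \<and> Q * \<nu> < n"
      using eventually_gt_at_top[of "Q * \<nu>"] by eventually_elim auto
    then obtain n where n: "hahn_abs c (?S n - \<sigma>) < T" "Q * \<nu> < n"
      by (metis (mono_tags, lifting) eventually_happens trivial_limit_sequentially)
    define R where "R = (\<Sum>i\<in>{..<n} - {Q * \<nu>}. fps_nth (tau_fps Q g) i * \<alpha> ^ i)"
    have S_eq: "?S n = fps_nth (tau_fps Q g) (Q * \<nu>) * \<alpha> ^ (Q * \<nu>) + R"
      unfolding R_def using n(2) by (intro sum.remove) auto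
    have "hahn_abs c R \<le> B" unfolding R_def
    proof (rule hahn_abs_sum_le[OF c])
      show "0 \<le> B" using C \<rho> by (simp add: B_def)
    qed (rule other, simp)
    then have "hahn_abs c R < hahn_abs c (fps_nth (tau_fps Q g) (Q * \<nu>) * \<alpha> ^ (Q * \<nu>))"
      using lead_term \<open>B < T\<close> by simp
    from hahn_abs_add_eq[OF c this] have Sn: "hahn_abs c (?S n) = T"
      by (simp only: S_eq lead_term)
    have "hahn_abs c (?S n + (\<sigma> - ?S n)) = hahn_abs c (?S n)"
      using n(1) Sn hahn_abs_minus_commute[OF c, of \<sigma>] by (intro hahn_abs_add_eq[OF c]) simp
    then show ?thesis using Sn by (simp add: T_def)
  qed
  then show ?thesis unfolding \<nu>_def \<rho>_def by blast
qed

end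

end

section \<open>Polynomials in \<open>x\<close> over \<open>C(t)\<close>\<close>

lemma poly_fls_X: "poly (map_poly fls_const P) fls_X = fps_to_fls (fps_of_poly P)"
  for P :: "'a::field poly"
  by (induction P) (simp_all add: map_poly_pCons fps_of_poly_pCons fls_times_fps_to_fls mult.commute)

lemma C_t_poly_clear_denominators:
  assumes "\<And>i. coeff P i \<in> (C_t :: 'c::field hahn set)"
  obtains w m where "w \<in> tpoly m" "w \<noteq> 0" "\<And>i. coeff (smult w P) i \<in> tpoly m"
proof -
  obtain m w where w: "w \<in> tpoly m" "w \<noteq> 0" "\<forall>i\<in>{..degree P}. w * coeff P i \<in> tpoly m"
    using C_t_common_denominator[of "{..degree P}" "coeff P"] assms by auto
  have "coeff (smult w P) i \<in> tpoly m" for i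
    using w(3) by (cases "i \<le> degree P") (auto simp: coeff_eq_0)
  then show ?thesis using that w by blast
qed

text \<open>Numerator and denominator are rescaled by both common denominators in t. The relation is
  multiplied out because \<open>y\<close> need not be a power series.\<close>

lemma C_t_x_fraction:
  fixes y :: "'c::field hahn fls"
  assumes "y \<in> C_t_x"
  obtains S R m where "S \<noteq> 0" "\<And>i. coeff R i \<in> tpoly m" "\<And>i. coeff S i \<in> tpoly m"
    "y * fps_to_fls (fps_of_poly S) = fps_to_fls (fps_of_poly R)"
proof -
  obtain P Q where PQ: "y = poly P fls_X / poly Q fls_X" "poly Q fls_X \<noteq> 0"
    "\<And>i. coeff P i \<in> fls_const ` (C_t :: 'c hahn set)"
    "\<And>i. coeff Q i \<in> fls_const ` (C_t :: 'c hahn set)"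
    using assms unfolding C_t_x_def adjoin_def by blast
  \<comment> \<open>Reading off the coefficient of index 0 inverts \<open>fls_const\<close>.\<close>
  have *: "\<exists>P'. P = map_poly fls_const P' \<and> (\<forall>i. coeff P' i \<in> C_t)"
    if P: "\<And>i. coeff P i \<in> fls_const ` (C_t :: 'c hahn set)" for P
  proof (intro exI[of _ "map_poly (\<lambda>z. fls_nth z 0) P"] conjI allI)
    show "P = map_poly fls_const (map_poly (\<lambda>z. fls_nth z 0) P)"
    proof (intro poly_eqI)
      fix i
      obtain z where "coeff P i = fls_const z" using P[of i] by blast
      then show "coeff P i = coeff (map_poly fls_const (map_poly (\<lambda>z. fls_nth z 0) P)) i"
        by (simp add: coeff_map_poly)
    qed
    show "coeff (map_poly (\<lambda>z. fls_nth z 0) P) i \<in> C_t" for i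
      using P[of i] by (auto simp: coeff_map_poly)
  qed
  obtain P' where P': "P = map_poly fls_const P'" "\<And>i. coeff P' i \<in> C_t" using * PQ(3) by blast
  obtain Q' where Q': "Q = map_poly fls_const Q'" "\<And>i. coeff Q' i \<in> C_t" using * PQ(4) by blast
  obtain w m where w: "w \<in> tpoly m" "w \<noteq> 0" "\<And>i. coeff (smult w P') i \<in> tpoly m"
    using C_t_poly_clear_denominators P'(2) by blast
  obtain w' m' where w': "w' \<in> tpoly m'" "w' \<noteq> 0" "\<And>i. coeff (smult w' Q') i \<in> tpoly m'"
    using C_t_poly_clear_denominators Q'(2) by blast
  show ?thesis
  proof (rule that)
    show "smult w (smult w' Q') \<noteq> 0" using PQ(2) Q' w(2) w'(2) by auto
    show "coeff (smult w' (smult w P')) i \<in> tpoly (m + m')" for i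
      using tpoly_mult[OF w'(1) w(3)[of i]] by (simp add: add.commute mult.assoc)
    show "coeff (smult w (smult w' Q')) i \<in> tpoly (m + m')" for i
      using tpoly_mult[OF w(1) w'(3)[of i]] by (simp add: mult.assoc)
    show "y * fps_to_fls (fps_of_poly (smult w (smult w' Q'))) =
        fps_to_fls (fps_of_poly (smult w' (smult w P')))"
      using PQ(1,2) unfolding P'(1) Q'(1) poly_fls_X
      by (simp add: fps_of_poly_smult fls_times_fps_to_fls ac_simps)
  qed
qed

lemma coeff_mult_tpoly:
  assumes "\<And>i. coeff R i \<in> tpoly m" "\<And>i. coeff S i \<in> tpoly m'"
  shows "coeff (R * S) i \<in> tpoly (m + m')"
  unfolding coeff_mult by (intro tpoly_sum tpoly_mult assms)

text \<open>Multiplied by the denominators of \<open>a\<close> and \<open>b\<close>, both sides are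
  images of power series under an injective map. The equation thus moves to power series, where
  \<open>tau_fps\<close> and evaluation at \<alpha> are available.\<close>

lemma functional_equation_clear_denominators:
  fixes a b :: "'c::field hahn fls"
  assumes "a \<in> C_t_x" "b \<in> C_t_x" "fps_to_fls g = a * fps_to_fls f + b"
  obtains B A m A' where "B \<noteq> 0" "\<And>i. coeff A i \<in> tpoly m" "\<And>i. coeff A' i \<in> tpoly m"
    "\<And>i. coeff B i \<in> tpoly m" "fps_of_poly B * g = fps_of_poly A * f + fps_of_poly A'"
proof -
  obtain S R m where a: "S \<noteq> 0" "\<And>i. coeff R i \<in> tpoly m" "\<And>i. coeff S i \<in> tpoly m"
    "a * fps_to_fls (fps_of_poly S) = fps_to_fls (fps_of_poly R)"
    by (rule C_t_x_fraction[OF assms(1)]) blast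
  obtain S' R' m' where b: "S' \<noteq> 0" "\<And>i. coeff R' i \<in> tpoly m'" "\<And>i. coeff S' i \<in> tpoly m'"
    "b * fps_to_fls (fps_of_poly S') = fps_to_fls (fps_of_poly R')"
    by (rule C_t_x_fraction[OF assms(2)]) blast
  let ?h = "\<lambda>P. fps_to_fls (fps_of_poly P)"
  have "?h S * ?h S' * fps_to_fls g = (a * ?h S) * ?h S' * fps_to_fls f + ?h S * (b * ?h S')"
    unfolding assms(3) by (simp only: algebra_simps)
  also have "\<dots> = ?h R * ?h S' * fps_to_fls f + ?h S * ?h R'"
    unfolding a(4) b(4) ..
  finally have "fps_to_fls (fps_of_poly (S * S') * g) =
      fps_to_fls (fps_of_poly (R * S') * f + fps_of_poly (S * R'))"
    by (simp add: fps_of_poly_mult fls_times_fps_to_fls)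
  then have "fps_of_poly (S * S') * g = fps_of_poly (R * S') * f + fps_of_poly (S * R')"
    by (simp only: fps_to_fls_eq_iff)
  moreover have "S * S' \<noteq> 0" using a(1) b(1) by simp
  ultimately show ?thesis
    by (intro that[of "S * S'" "R * S'" "m + m'" "S * R'"] coeff_mult_tpoly a(2,3) b(2,3))
qed

section \<open>The auxiliary function\<close>

definition auxiliary_fps :: "nat \<Rightarrow> (nat \<times> nat \<Rightarrow> 'c::field hahn) \<Rightarrow> 'c hahn fps \<Rightarrow> 'c hahn fps" where
  "auxiliary_fps N P f = (\<Sum>(i, j)\<in>{..N} \<times> {..N}. fps_const (P (i, j)) * fps_X ^ i * f ^ j)"

lemma fps_power_nth_subfield:
  assumes "is_subfield F" "\<And>i. fps_nth f i \<in> F"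
  shows "fps_nth (f ^ j) i \<in> F"
proof (induction j arbitrary: i)
  case 0
  show ?case using assms by (simp add: is_subfieldD)
next
  case (Suc j)
  then show ?case using assms
    by (auto simp: fps_mult_nth intro!: is_subfield_sum is_subfieldD)
qed

text \<open>There are \<open>(N + 1) ^ 2\<close> unknown coefficients against \<open>N ^ 2\<close>
  vanishing conditions; denominators are cleared afterwards.\<close>

lemma auxiliary_fps_exists:
  fixes f :: "'c::field hahn fps"
  assumes "\<And>i. fps_nth f i \<in> C_t"
  obtains P m where "\<And>ij. ij \<in> {..N} \<times> {..N} \<Longrightarrow> P ij \<in> tpoly m"
    "\<exists>ij\<in>{..N} \<times> {..N}. P ij \<noteq> 0"
    "\<And>k. k < N ^ 2 \<Longrightarrow> fps_nth (auxiliary_fps N P f) k = 0"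
proof -
  let ?I = "{..N} \<times> {..N}"
  define A where "A k ij = (case ij of (i, j) \<Rightarrow> fps_nth (fps_X ^ i * f ^ j) k)" for k ij
  have "A k ij \<in> C_t" for k ij
    using fps_power_nth_subfield[OF is_subfield_C_t assms]
    by (auto simp: A_def fps_X_power_mult_nth is_subfieldD[OF is_subfield_C_t] split: prod.split)
  moreover have "card {..<N ^ 2} < card ?I" by (simp add: power2_eq_square)
  ultimately have "\<exists>x. (\<forall>ij\<in>?I. x ij \<in> C_t) \<and> (\<exists>ij\<in>?I. x ij \<noteq> 0) \<and> (\<forall>k\<in>{..<N ^ 2}. (\<Sum>ij\<in>?I. A k ij * x ij) = 0)"
    by (intro homogeneous_system_nontrivial_solution is_subfield_C_t) auto
  then obtain x where x: "\<forall>ij\<in>?I. x ij \<in> C_t" "\<exists>ij\<in>?I. x ij \<noteq> 0"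
    "\<And>k. k < N ^ 2 \<Longrightarrow> (\<Sum>ij\<in>?I. A k ij * x ij) = 0" by blast
  obtain m w where w: "w \<in> tpoly m" "w \<noteq> 0" "\<forall>ij\<in>?I. w * x ij \<in> tpoly m"
    using C_t_common_denominator[of ?I x] x(1) by auto
  show ?thesis
  proof (rule that[of "\<lambda>ij. w * x ij" m])
    fix k assume "k < N ^ 2"
    have "fps_nth (auxiliary_fps N (\<lambda>ij. w * x ij) f) k = (\<Sum>ij\<in>?I. w * (A k ij * x ij))"
      unfolding auxiliary_fps_def fps_sum_nth
      by (intro sum.cong refl) (auto simp: A_def mult.assoc)
    also have "\<dots> = w * (\<Sum>ij\<in>?I. A k ij * x ij)" by (simp add: sum_distrib_left)
    finally show "fps_nth (auxiliary_fps N (\<lambda>ij. w * x ij) f) k = 0" using x(3) \<open>k < N ^ 2\<close> by simp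
  qed (use x(2) w in auto)
qed

text \<open>Grouped by powers of \<open>f\<close>, with \<open>R j\<close> the polynomial in x in
  front of \<open>f ^ j\<close>, a vanishing auxiliary function would be an algebraic equation for
  \<open>f\<close> over \<open>C_t_x\<close>.\<close>

lemma auxiliary_fps_nonzero:
  fixes f :: "'c::field hahn fps"
  assumes "transcendental_over C_t_x (fps_to_fls f)"
    and P: "\<And>ij. ij \<in> {..N} \<times> {..N} \<Longrightarrow> P ij \<in> tpoly m"
    and nz: "\<exists>ij\<in>{..N} \<times> {..N}. P ij \<noteq> 0"
  shows "auxiliary_fps N P f \<noteq> 0"
proof
  assume zero: "auxiliary_fps N P f = 0"
  define R where "R j = (\<Sum>i\<le>N. monom (P (i, j)) i)" for j
  define G where "G = (\<Sum>j\<le>N. monom (fps_to_fls (fps_of_poly (R j))) j)"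
  have fR: "fps_of_poly (R j) = (\<Sum>i\<le>N. fps_const (P (i, j)) * fps_X ^ i)" for j
    by (simp add: R_def fps_of_poly_sum fps_of_poly_monom)
  have coeff_R: "coeff (R j) i = (if i \<le> N then P (i, j) else 0)" for i j
    by (auto simp: R_def coeff_sum)
  have coeff_G: "coeff G j = (if j \<le> N then fps_to_fls (fps_of_poly (R j)) else 0)" for j
    by (auto simp: G_def coeff_sum)
  have C_t_0: "0 \<in> (C_t :: 'c hahn set)" and C_t_1: "1 \<in> (C_t :: 'c hahn set)"
    by (rule is_subfieldD[OF is_subfield_C_t])+
  have coeff_1_C_t: "coeff 1 i \<in> fls_const ` (C_t :: 'c hahn set)" for i
    using C_t_0 C_t_1 by (auto simp: coeff_1 image_iff intro: bexI[of _ 1] bexI[of _ 0])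
  have "poly (map_poly fls_const (R j)) fls_X \<in> C_t_x" if "j \<le> N" for j
    unfolding C_t_x_def adjoin_def
  proof (intro CollectI exI conjI allI)
    show "coeff (map_poly fls_const (R j)) i \<in> fls_const ` (C_t :: 'c hahn set)" for i
      using that C_t_0 by (auto simp: coeff_map_poly coeff_R intro!: imageI tpoly_in_C_t P)
    show "coeff 1 i \<in> fls_const ` (C_t :: 'c hahn set)" for i
      by (rule coeff_1_C_t)
  qed auto
  moreover have "0 \<in> (C_t_x :: 'c hahn fls set)"
    unfolding C_t_x_def adjoin_def
  proof (intro CollectI exI conjI allI)
    show "0 = poly 0 fls_X / poly 1 (fls_X :: 'c hahn fls)" by simp
    show "coeff 1 i \<in> fls_const ` (C_t :: 'c hahn set)" for i
      by (rule coeff_1_C_t)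
  qed (use C_t_0 in \<open>auto simp: image_iff intro: bexI[of _ 0]\<close>)
  ultimately have "coeff G j \<in> C_t_x" for j
    by (simp add: coeff_G poly_fls_X)
  moreover have "G \<noteq> 0"
  proof -
    obtain i j where ij: "i \<le> N" "j \<le> N" "P (i, j) \<noteq> 0" using nz by auto
    then have "coeff (R j) i \<noteq> 0" by (simp add: coeff_R)
    then have "R j \<noteq> 0" by auto
    then have "coeff G j \<noteq> 0" using ij by (simp add: coeff_G)
    then show ?thesis by auto
  qed
  moreover have "poly G (fps_to_fls f) = 0"
  proof -
    have "poly G (fps_to_fls f) = fps_to_fls (\<Sum>j\<le>N. fps_of_poly (R j) * f ^ j)"
    proof -
      have "fps_to_fls (sum h J) = (\<Sum>j\<in>J. fps_to_fls (h j :: 'c hahn fps))" for h and J :: "nat set"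
        by (induction J rule: infinite_finite_induct) auto
      then show ?thesis
        by (simp add: G_def poly_sum poly_monom fls_times_fps_to_fls fps_to_fls_power)
    qed
    also have "(\<Sum>j\<le>N. fps_of_poly (R j) * f ^ j) = auxiliary_fps N P f"
      unfolding auxiliary_fps_def fR sum.cartesian_product[symmetric] sum_distrib_right
      by (rule sum.swap)
    finally show ?thesis using zero by simp
  qed
  ultimately have "algebraic_over C_t_x (fps_to_fls f)"
    unfolding algebraic_over_def by (intro exI[of _ G] conjI allI)
  with assms(1) show False ..
qed

section \<open>Specialisation at \<open>\<alpha>\<close>\<close>

lemma fps_of_poly_altdef_sum: "fps_of_poly P = (\<Sum>i\<le>degree P. fps_const (coeff P i) * fps_X ^ i)"
  for P :: "'a::comm_ring_1 poly"
proof -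
  have "fps_of_poly P = fps_of_poly (\<Sum>i\<le>degree P. monom (coeff P i) i)"
    by (simp add: poly_as_sum_of_monoms)
  then show ?thesis by (simp add: fps_of_poly_sum fps_of_poly_monom)
qed

text \<open>A fraction for \<alpha> is fixed, so that powers of \<open>v\<close> clear powers of
  \<alpha> with a degree in t linear in the exponent.\<close>

locale mahler_setup =
  fixes c :: real and p q e :: nat and \<alpha> u v :: "'c::field hahn" and s :: nat
  assumes c: "c > 1" and p: "prime p" and q: "q = p ^ e" and char: "CHAR('c) = p" and q2: "q \<ge> 2"
    and \<alpha>: "0 < hahn_abs c \<alpha>" "hahn_abs c \<alpha> < 1"
    and uv: "\<alpha> = u / v" "u \<in> tpoly s" "v \<in> tpoly s" "v \<noteq> 0"
begin

lemma q_power: "q ^ n = p ^ (e * n)"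
  by (simp add: q power_mult)

lemma q_power_pos: "q ^ n > 0"
  using q2 by simp

lemma q_power_gt: "n < q ^ n"
  using q2 by (intro power_gt_expt) simp

lemmas tau_hom = tau_add[OF p q_power char] tau_mult[OF p q_power char] tau_sum[OF p q_power char]
lemmas tau_fps_hom = tau_fps_add[OF p q_power char] tau_fps_mult[OF p q_power char]
  tau_fps_sum[OF p q_power char] tau_fps_const[OF p q_power char] tau_fps_power[OF p q_power char]
  tau_fps_X[OF p q_power char]

lemma tau_C_t:
  fixes x :: "'c hahn"
  assumes "x \<in> C_t"
  shows "tau (q ^ n) x \<in> C_t"
proof -
  obtain m w z where x: "w \<in> tpoly m" "z \<in> tpoly m" "z \<noteq> 0" "x = w / z"
    using assms unfolding C_t_iff by blast
  have "tau (q ^ n) x * tau (q ^ n) z = tau (q ^ n) w"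
    using tau_hom(2)[of n x z] x(3,4) by auto
  then have "tau (q ^ n) x = tau (q ^ n) w / tau (q ^ n) z"
    using x(3) q_power_pos[of n] by (metis nonzero_eq_divide_eq tau_eq_0_iff)
  then show ?thesis unfolding C_t_iff using x tpoly_tau[OF q_power_pos] q_power_pos
    by (metis tau_eq_0_iff)
qed

text \<open>The number obtained by applying \<tau> to \<open>P\<close> \<open>n\<close> times, as to
  a power series in x, and evaluating at \<alpha>.\<close>

definition tau_poly_value :: "nat \<Rightarrow> 'c hahn poly \<Rightarrow> 'c hahn" where
  "tau_poly_value n P = (\<Sum>i\<le>degree P. tau (q ^ n) (coeff P i) * \<alpha> ^ (q ^ n * i))"

lemma has_value_tau_poly: "has_value c \<alpha> (tau_fps (q ^ n) (fps_of_poly P)) (tau_poly_value n P)"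
  unfolding fps_of_poly_altdef_sum tau_poly_value_def tau_fps_hom power_mult
  by (intro has_value_sum[OF c \<alpha>] has_value_mult[OF c \<alpha>] has_value_power[OF c \<alpha>] has_value_const[OF c \<alpha>] has_value_X[OF c \<alpha>])

lemma bounded_fps_of_poly: "bounded_coeffs c (hahn_abs c \<alpha>) (fps_of_poly P)"
  unfolding fps_of_poly_altdef_sum using \<alpha>
  by (intro bounded_coeffs_sum[OF c] bounded_coeffs_mult[OF c] bounded_coeffs_power[OF c]
      bounded_coeffs_const[OF c] bounded_coeffs_X[OF c]) auto

lemma alpha_power_clear:
  assumes "i \<le> E"
  shows "v ^ (Q * E) * \<alpha> ^ (Q * i) = u ^ (Q * i) * v ^ (Q * (E - i))"
proof -
  have "Q * E = Q * (E - i) + Q * i" using assms by (simp flip: distrib_left)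
  then have "v ^ (Q * E) = v ^ (Q * (E - i)) * v ^ (Q * i)" by (simp add: power_add)
  then show ?thesis using uv(4) by (simp add: uv(1) power_divide)
qed

lemma tpoly_alpha_power_clear:
  assumes "i \<le> E"
  shows "v ^ (Q * E) * \<alpha> ^ (Q * i) \<in> tpoly (Q * E * s)"
proof -
  have "u ^ (Q * i) * v ^ (Q * (E - i)) \<in> tpoly (Q * i * s + Q * (E - i) * s)"
    by (intro tpoly_mult tpoly_power uv)
  also have "Q * i * s + Q * (E - i) * s = Q * E * s"
    using assms by (simp flip: distrib_left distrib_right)
  finally show ?thesis by (simp only: alpha_power_clear[OF assms])
qed

text \<open>As \<tau> does not change degrees in t, the coefficients keep the bound \<open>m\<close>
  for every \<open>n\<close>; all growth comes from the powers of \<alpha> and is linear in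
  \<open>q ^ n\<close>.\<close>

lemma tau_poly_value_clear:
  assumes "\<And>i. coeff P i \<in> tpoly m" "degree P \<le> E"
  shows "v ^ (q ^ n * E) * tau_poly_value n P \<in> tpoly ((m + E * s) * q ^ n)"
proof -
  have "v ^ (q ^ n * E) * tau_poly_value n P
      = (\<Sum>i\<le>degree P. tau (q ^ n) (coeff P i) * (v ^ (q ^ n * E) * \<alpha> ^ (q ^ n * i)))"
    by (simp add: tau_poly_value_def sum_distrib_left ac_simps)
  also have "\<dots> \<in> tpoly (m + q ^ n * E * s)"
    using assms by (intro tpoly_sum tpoly_mult tpoly_tau q_power_pos tpoly_alpha_power_clear) auto
  also have "m + q ^ n * E * s \<le> (m + E * s) * q ^ n"
  proof -
    have "m * 1 \<le> m * q ^ n" using q_power_pos[of n] by (intro mult_le_mono2) linarith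
    moreover have "(m + E * s) * q ^ n = m * q ^ n + q ^ n * E * s" by (simp add: algebra_simps)
    ultimately show ?thesis by linarith
  qed
  from tpoly_mono[OF this] calculation show ?thesis by blast
qed

lemma auxiliary_has_value:
  assumes "has_value c \<alpha> (tau_fps (q ^ n) f) \<beta>"
  shows "has_value c \<alpha> (tau_fps (q ^ n) (auxiliary_fps N P f))
    (\<Sum>(i, j)\<in>{..N} \<times> {..N}. tau (q ^ n) (P (i, j)) * \<alpha> ^ (q ^ n * i) * \<beta> ^ j)"
  unfolding auxiliary_fps_def tau_fps_hom power_mult case_prod_beta
  by (intro has_value_sum[OF c \<alpha>] has_value_mult[OF c \<alpha>] has_value_power[OF c \<alpha>]
      has_value_const[OF c \<alpha>] has_value_X[OF c \<alpha>] assms)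

lemma bounded_auxiliary:
  assumes "bounded_coeffs c (hahn_abs c \<alpha>) f"
  shows "bounded_coeffs c (hahn_abs c \<alpha>) (auxiliary_fps N P f)"
  unfolding auxiliary_fps_def case_prod_beta using \<alpha>(1)
  by (intro bounded_coeffs_sum[OF c] bounded_coeffs_mult[OF c] bounded_coeffs_power[OF c]
      bounded_coeffs_const[OF c] bounded_coeffs_X[OF c] assms) auto

text \<open>The relations between consecutive values are composed. Degrees in t add up to
  \<open>K * q ^ n + K * q ^ n\<close>, which fits below \<open>K * q ^ Suc n\<close> because
  \<open>q \<ge> 2\<close>; so the bound stays proportional to \<open>q ^ n\<close>.\<close>

lemma values_affine:
  assumes eq: "fps_of_poly B * tau_fps q f = fps_of_poly A * f + fps_of_poly A'"
    and coeffs: "\<And>i. coeff A i \<in> tpoly m" "\<And>i. coeff A' i \<in> tpoly m" "\<And>i. coeff B i \<in> tpoly m"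
    and E: "degree A \<le> E" "degree A' \<le> E" "degree B \<le> E"
    and \<beta>: "\<And>n. n \<ge> n1 \<Longrightarrow> has_value c \<alpha> (tau_fps (q ^ n) f) (\<beta> n)"
    and B: "\<And>n. n \<ge> n1 \<Longrightarrow> tau_poly_value n B \<noteq> 0"
    and K: "K = m + E * s" and n: "n1 \<le> n"
  shows "\<exists>\<Delta> \<Gamma> \<Gamma>'. \<Delta> \<in> tpoly (K * q ^ n) \<and> \<Gamma> \<in> tpoly (K * q ^ n) \<and> \<Gamma>' \<in> tpoly (K * q ^ n) \<and>
    \<Delta> \<noteq> 0 \<and> \<Delta> * \<beta> n = \<Gamma> * \<beta> n1 + \<Gamma>'"
  using n
proof (induction n rule: dec_induct)
  case base
  show ?case by (intro exI[of _ 1] exI[of _ 0] conjI) auto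
next
  case (step n)
  then obtain \<Delta> \<Gamma> \<Gamma>' where IH: "\<Delta> \<in> tpoly (K * q ^ n)" "\<Gamma> \<in> tpoly (K * q ^ n)" "\<Gamma>' \<in> tpoly (K * q ^ n)"
    "\<Delta> \<noteq> 0" "\<Delta> * \<beta> n = \<Gamma> * \<beta> n1 + \<Gamma>'" by blast
  let ?w = "v ^ (q ^ n * E)"
  define a where "a = ?w * tau_poly_value n A"
  define a' where "a' = ?w * tau_poly_value n A'"
  define b where "b = ?w * tau_poly_value n B"
  have ab: "a \<in> tpoly (K * q ^ n)" "a' \<in> tpoly (K * q ^ n)" "b \<in> tpoly (K * q ^ n)"
    unfolding a_def a'_def b_def K by (intro tau_poly_value_clear coeffs E)+
  have "b \<noteq> 0" using B step uv(4) by (simp add: b_def)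
  \<comment> \<open>Both sides of the functional equation, twisted \<open>n\<close> times, are
    evaluated at \<alpha>; uniqueness of the value gives the recursion for \<beta>.\<close>
  have "has_value c \<alpha> (tau_fps (q ^ n) (fps_of_poly B * tau_fps q f))
      (tau_poly_value n B * \<beta> (Suc n))"
    using \<beta>[of "Suc n"] step q2
    by (simp add: tau_fps_hom tau_fps_tau_fps mult.commute[of "q ^ n"])
       (intro has_value_mult[OF c \<alpha>] has_value_tau_poly)
  moreover have "has_value c \<alpha> (tau_fps (q ^ n) (fps_of_poly B * tau_fps q f))
      (tau_poly_value n A * \<beta> n + tau_poly_value n A')"
    unfolding eq tau_fps_hom using step
    by (intro has_value_add[OF c \<alpha>] has_value_mult[OF c \<alpha>] has_value_tau_poly \<beta>) auto
  ultimately have "tau_poly_value n B * \<beta> (Suc n) = tau_poly_value n A * \<beta> n + tau_poly_value n A'"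
    by (rule has_value_unique[OF c \<alpha>])
  then have rec: "b * \<beta> (Suc n) = a * \<beta> n + a'"
    by (simp add: a_def a'_def b_def mult.assoc distrib_left[symmetric])
  have "\<Delta> * b * \<beta> (Suc n) = a * (\<Delta> * \<beta> n) + \<Delta> * a'"
    using rec by (simp add: mult.assoc distrib_left mult.left_commute)
  also have "\<dots> = (a * \<Gamma>) * \<beta> n1 + (a * \<Gamma>' + \<Delta> * a')"
    unfolding IH(5) by (simp add: algebra_simps)
  finally have "\<Delta> * b * \<beta> (Suc n) = (a * \<Gamma>) * \<beta> n1 + (a * \<Gamma>' + \<Delta> * a')" .
  moreover have le: "K * q ^ n + K * q ^ n \<le> K * q ^ Suc n"
  proof -
    have "(K * q ^ n) * 2 \<le> (K * q ^ n) * q" by (intro mult_le_mono2 q2)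
    also have "\<dots> = K * q ^ Suc n" by (simp add: mult.assoc mult.commute[of q])
    finally show ?thesis by linarith
  qed
  have "\<Delta> * b \<in> tpoly (K * q ^ Suc n)" "a * \<Gamma> \<in> tpoly (K * q ^ Suc n)"
    "a * \<Gamma>' + \<Delta> * a' \<in> tpoly (K * q ^ Suc n)"
    using IH ab le by (auto intro!: tpoly_add tpoly_mult_le simp del: power_Suc)
  moreover have "\<Delta> * b \<noteq> 0" using IH \<open>b \<noteq> 0\<close> by simp
  ultimately show ?case by blast
qed

text \<open>Two kinds of denominators are cleared: \<open>v ^ (q ^ n * N)\<close> for the powers of
  \<alpha> and \<open>\<Delta> ^ N\<close> for the powers of \<beta>. Since \<beta> is affine in
  \<open>\<beta>1\<close>, the degree in \<open>\<beta>1\<close> stays at most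
  \<open>N\<close>.\<close>

lemma auxiliary_value_bound:
  assumes P: "\<And>ij. ij \<in> {..N} \<times> {..N} \<Longrightarrow> P ij \<in> tpoly m"
    and \<Delta>: "\<Delta> \<in> tpoly L" "\<Gamma> \<in> tpoly L" "\<Gamma>' \<in> tpoly L" "\<Delta> * \<beta> = \<Gamma> * \<beta>1 + \<Gamma>'"
  shows "(v ^ q ^ n * \<Delta>) ^ N * (\<Sum>(i, j)\<in>{..N} \<times> {..N}. tau (q ^ n) (P (i, j)) * \<alpha> ^ (q ^ n * i) * \<beta> ^ j)
    \<in> poly_values \<beta>1 N (m + q ^ n * N * s + N * L)"
proof -
  let ?Q = "q ^ n"
  have "(v ^ ?Q * \<Delta>) ^ N * (\<Sum>(i, j)\<in>{..N} \<times> {..N}. tau ?Q (P (i, j)) * \<alpha> ^ (?Q * i) * \<beta> ^ j) =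
    (\<Sum>(i, j)\<in>{..N} \<times> {..N}. (tau ?Q (P (i, j)) * (v ^ (?Q * N) * \<alpha> ^ (?Q * i))) *
       (\<Delta> ^ (N - j) * (\<Gamma> * \<beta>1 + \<Gamma>') ^ j))"
    unfolding sum_distrib_left
  proof (rule sum.cong[OF refl])
    fix ij assume "ij \<in> {..N} \<times> {..N}"
    then obtain i j where ij: "ij = (i, j)" and "j \<in> {..N}" by blast
    then have "\<Delta> ^ N = \<Delta> ^ (N - j) * \<Delta> ^ j" by (simp flip: power_add)
    then have "\<Delta> ^ N * \<beta> ^ j = \<Delta> ^ (N - j) * (\<Gamma> * \<beta>1 + \<Gamma>') ^ j"
      by (simp add: power_mult_distrib mult.assoc flip: \<Delta>(4))
    moreover have "(v ^ ?Q * \<Delta>) ^ N * (tau ?Q (P (i, j)) * \<alpha> ^ (?Q * i) * \<beta> ^ j) =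
      tau ?Q (P (i, j)) * (v ^ (?Q * N) * \<alpha> ^ (?Q * i)) * (\<Delta> ^ N * \<beta> ^ j)"
      by (simp add: power_mult_distrib mult_ac flip: power_mult)
    ultimately show "(v ^ ?Q * \<Delta>) ^ N * (case ij of (i, j) \<Rightarrow> tau ?Q (P (i, j)) * \<alpha> ^ (?Q * i) * \<beta> ^ j) =
      (case ij of (i, j) \<Rightarrow> tau ?Q (P (i, j)) * (v ^ (?Q * N) * \<alpha> ^ (?Q * i)) *
        (\<Delta> ^ (N - j) * (\<Gamma> * \<beta>1 + \<Gamma>') ^ j))"
      by (simp add: ij)
  qed
  also have "\<dots> \<in> poly_values \<beta>1 N (m + ?Q * N * s + N * L)"
  proof (rule poly_values_sum)
    fix ij assume "ij \<in> {..N} \<times> {..N}"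
    then obtain i j where ij: "ij = (i, j)" "i \<in> {..N}" "j \<in> {..N}" by blast
    have 1: "tau ?Q (P (i, j)) * (v ^ (?Q * N) * \<alpha> ^ (?Q * i)) \<in> poly_values \<beta>1 0 (m + ?Q * N * s)"
      using ij by (intro poly_values_tpoly tpoly_mult tpoly_tau q_power_pos P tpoly_alpha_power_clear) auto
    have "\<Gamma> * \<beta>1 \<in> poly_values \<beta>1 1 L"
      using poly_values_mult[OF poly_values_tpoly[OF \<Delta>(2)] poly_values_self, where N = 0] by simp
    then have "(\<Gamma> * \<beta>1 + \<Gamma>') ^ j \<in> poly_values \<beta>1 (j * 1) (j * L)"
      by (intro poly_values_power poly_values_add poly_values_tpoly[OF \<Delta>(3)])
    moreover have "\<Delta> ^ (N - j) \<in> poly_values \<beta>1 0 ((N - j) * L)"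
      by (intro poly_values_tpoly tpoly_power \<Delta>)
    ultimately have 2: "\<Delta> ^ (N - j) * (\<Gamma> * \<beta>1 + \<Gamma>') ^ j \<in> poly_values \<beta>1 (0 + j * 1) ((N - j) * L + j * L)"
      by (intro poly_values_mult)
    have "(N - j) * L + j * L = N * L" using ij by (simp flip: distrib_right)
    then have "0 + (0 + j * 1) \<le> N"
      "m + ?Q * N * s + ((N - j) * L + j * L) \<le> m + ?Q * N * s + N * L"
      using ij by auto
    from poly_values_mono[OF poly_values_mult[OF 1 2] this]
    show "(case ij of (i, j) \<Rightarrow> tau ?Q (P (i, j)) * (v ^ (?Q * N) * \<alpha> ^ (?Q * i)) *
        (\<Delta> ^ (N - j) * (\<Gamma> * \<beta>1 + \<Gamma>') ^ j)) \<in> poly_values \<beta>1 N (m + ?Q * N * s + N * L)"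
      by (simp add: ij(1))
  qed
  finally show ?thesis .
qed

section \<open>Comparison of the upper and lower bounds\<close>

lemma values_eventually_transcendental:
  assumes f: "\<And>i. fps_nth f i \<in> C_t" "bounded_coeffs c (hahn_abs c \<alpha>) f"
      "transcendental_over C_t_x (fps_to_fls f)"
    and eq: "fps_of_poly B * tau_fps q f = fps_of_poly A * f + fps_of_poly A'"
    and coeffs: "\<And>i. coeff A i \<in> tpoly m" "\<And>i. coeff A' i \<in> tpoly m" "\<And>i. coeff B i \<in> tpoly m"
    and "B \<noteq> 0"
    and \<beta>: "\<And>n. n \<ge> 1 \<Longrightarrow> has_value c \<alpha> (tau_fps (q ^ n) f) (\<beta> n)"
  shows "\<forall>\<^sub>F n in sequentially. transcendental_over C_t (\<beta> n)"
proof (rule ccontr)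
  assume "\<not> ?thesis"
  then have freq: "\<exists>n\<ge>n0. algebraic_over C_t (\<beta> n)" for n0
    unfolding eventually_sequentially by blast
  define \<rho> where "\<rho> = hahn_abs c \<alpha>"
  have \<rho>: "0 < \<rho>" "\<rho> < 1" using \<alpha> by (auto simp: \<rho>_def)
  have "fps_of_poly B \<noteq> 0" using \<open>B \<noteq> 0\<close> by simp
  from hahn_abs_value_tau[OF c \<alpha> bounded_fps_of_poly this] obtain Q0 where Q0:
    "\<And>Q \<sigma>. Q \<ge> Q0 \<Longrightarrow> has_value c \<alpha> (tau_fps Q (fps_of_poly B)) \<sigma> \<Longrightarrow>
      hahn_abs c \<sigma> = hahn_abs c (fps_nth (fps_of_poly B) (subdegree (fps_of_poly B))) * \<rho> ^ (Q * subdegree (fps_of_poly B))"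
    unfolding \<rho>_def by blast
  \<comment> \<open>The leading factor of the recursion does not vanish at \<alpha> for large
    \<open>n\<close>, by the exact formula for its absolute value.\<close>
  have B: "tau_poly_value n B \<noteq> 0" if "n \<ge> Q0" for n
  proof -
    have "q ^ n \<ge> Q0" using that q_power_gt[of n] by linarith
    moreover have "fps_nth (fps_of_poly B) (subdegree (fps_of_poly B)) \<noteq> 0"
      using \<open>fps_of_poly B \<noteq> 0\<close> by (rule nth_subdegree_nonzero)
    ultimately have "hahn_abs c (tau_poly_value n B) \<noteq> 0"
      using Q0[OF _ has_value_tau_poly] \<rho> c by simp
    then show ?thesis using c by simp
  qed
  obtain n1 where n1: "n1 \<ge> max 1 Q0" "algebraic_over C_t (\<beta> n1)" using freq by blast
  obtain \<kappa> D where liouville: "\<kappa> > 0" "\<And>N s x. x \<in> poly_values (\<beta> n1) N s \<Longrightarrow> x \<noteq> 0 \<Longrightarrow>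
      \<kappa> / c ^ (D * (s + N)) \<le> hahn_abs c x"
    using liouville_inequality[OF c n1(2)] by blast
  define E where "E = max (degree A) (max (degree A') (degree B))"
  define K where "K = m + E * s"
  have "\<exists>\<Delta> \<Gamma> \<Gamma>'. \<Delta> \<in> tpoly (K * q ^ n) \<and> \<Gamma> \<in> tpoly (K * q ^ n) \<and> \<Gamma>' \<in> tpoly (K * q ^ n) \<and>
    \<Delta> \<noteq> 0 \<and> \<Delta> * \<beta> n = \<Gamma> * \<beta> n1 + \<Gamma>'" if "n1 \<le> n" for n
    using that n1 by (intro values_affine[OF eq coeffs, of E n1 \<beta> K n] \<beta> B) (auto simp: E_def K_def)
  note affine = this
  \<comment> \<open>The base of the Liouville bound: the exponent \<open>D * (S + N)\<close> below
    grows by \<open>D * (s + K)\<close> for each unit of \<open>N * q ^ n\<close>.\<close>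
  define \<theta> where "\<theta> = c ^ (D * (s + K))"
  have \<theta>: "\<theta> > 0" using c by (simp add: \<theta>_def)
  \<comment> \<open>\<open>N\<close> is fixed before the auxiliary function and before
    \<open>n\<close>. The upper bound has exponent \<open>N ^ 2 * q ^ n\<close> and the lower one
    \<open>N * q ^ n\<close>, so \<open>\<rho> ^ N * \<theta> \<le> 1 / 2\<close> decides between
    them; the successor of \<open>N0\<close> ensures \<open>N \<ge> 1\<close>.\<close>
  obtain N0 where "\<rho> ^ N0 < 1 / (2 * \<theta>)"
    using real_arch_pow_inv[OF _ \<rho>(2), of "1 / (2 * \<theta>)"] \<theta> by auto
  moreover define N where "N = Suc N0"
  ultimately have N: "\<rho> ^ N * \<theta> \<le> 1 / 2" "N \<ge> 1"
  proof -
    assume N0: "\<rho> ^ N0 < 1 / (2 * \<theta>)" and "N = Suc N0"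
    then have "\<rho> ^ N \<le> \<rho> ^ N0" using \<rho> by (intro power_decreasing) auto
    then have "\<rho> ^ N \<le> 1 / (2 * \<theta>)" using N0 by linarith
    then show "\<rho> ^ N * \<theta> \<le> 1 / 2" using \<theta> by (simp add: field_simps)
  qed (simp add: N_def)
  obtain P m' where P: "\<And>ij. ij \<in> {..N} \<times> {..N} \<Longrightarrow> P ij \<in> tpoly m'"
      "\<exists>ij\<in>{..N} \<times> {..N}. P ij \<noteq> 0" "\<And>k. k < N ^ 2 \<Longrightarrow> fps_nth (auxiliary_fps N P f) k = 0"
    using auxiliary_fps_exists[OF f(1)] by blast
  define F where "F = auxiliary_fps N P f"
  have "F \<noteq> 0" unfolding F_def using auxiliary_fps_nonzero[OF f(3) P(1,2)] .
  define \<nu> where "\<nu> = subdegree F"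
  have \<nu>: "N ^ 2 \<le> \<nu>" unfolding \<nu>_def using \<open>F \<noteq> 0\<close> P(3) by (intro subdegree_geI) (auto simp: F_def)
  define l where "l = hahn_abs c (fps_nth F \<nu>)"
  have l: "l > 0" using \<open>F \<noteq> 0\<close> c by (simp add: l_def \<nu>_def)
  from hahn_abs_value_tau[OF c \<alpha> bounded_auxiliary[OF f(2)] \<open>F \<noteq> 0\<close>[unfolded F_def]] obtain Q1 where Q1:
    "\<And>Q \<sigma>. Q \<ge> Q1 \<Longrightarrow> has_value c \<alpha> (tau_fps Q F) \<sigma> \<Longrightarrow> hahn_abs c \<sigma> = l * \<rho> ^ (Q * \<nu>)"
    unfolding \<rho>_def l_def \<nu>_def F_def by blast
  have main: "\<kappa> / c ^ (D * (m' + N)) \<le> l * (1 / 2) ^ n" if n: "n \<ge> n1" "n \<ge> Q1" for n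
  proof -
    let ?Q = "q ^ n"
    define \<sigma> where "\<sigma> = (\<Sum>(i, j)\<in>{..N} \<times> {..N}. tau ?Q (P (i, j)) * \<alpha> ^ (?Q * i) * \<beta> n ^ j)"
    have "has_value c \<alpha> (tau_fps ?Q F) \<sigma>"
      unfolding F_def \<sigma>_def using n n1 by (intro auxiliary_has_value \<beta>) auto
    then have abs_\<sigma>: "hahn_abs c \<sigma> = l * \<rho> ^ (?Q * \<nu>)"
      using q_power_gt[of n] n by (intro Q1) auto
    then have "hahn_abs c \<sigma> \<noteq> 0" using l \<rho> by simp
    then have "\<sigma> \<noteq> 0" using c by simp
    obtain \<Delta> \<Gamma> \<Gamma>' where \<Delta>: "\<Delta> \<in> tpoly (K * ?Q)" "\<Gamma> \<in> tpoly (K * ?Q)" "\<Gamma>' \<in> tpoly (K * ?Q)"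
      "\<Delta> \<noteq> 0" "\<Delta> * \<beta> n = \<Gamma> * \<beta> n1 + \<Gamma>'" using affine[OF n(1)] by blast
    define S where "S = m' + ?Q * N * s + N * (K * ?Q)"
    define x where "x = (v ^ ?Q * \<Delta>) ^ N * \<sigma>"
    have "x \<in> poly_values (\<beta> n1) N S"
      unfolding x_def \<sigma>_def S_def by (rule auxiliary_value_bound[OF P(1) \<Delta>(1,2,3,5)])
    moreover have "x \<noteq> 0" using uv(4) \<Delta>(4) \<open>\<sigma> \<noteq> 0\<close> by (simp add: x_def)
    ultimately have "\<kappa> / c ^ (D * (S + N)) \<le> hahn_abs c x" by (rule liouville(2))
    \<comment> \<open>The multiplier is a polynomial in t, hence of absolute value at most
      1.\<close>
    also have "\<dots> \<le> hahn_abs c \<sigma>"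
    proof -
      have "(v ^ ?Q * \<Delta>) ^ N \<in> tpoly (N * (?Q * s + K * ?Q))"
        by (intro tpoly_power tpoly_mult uv \<Delta>)
      from hahn_abs_tpoly_le_1[OF c this] show ?thesis
        unfolding x_def hahn_abs_mult[OF c] using hahn_abs_nonneg[OF c]
        by (intro mult_left_le_one_le) auto
    qed
    also have "\<dots> \<le> l * \<rho> ^ (?Q * N ^ 2)"
      unfolding abs_\<sigma> using l \<rho> \<nu> by (intro mult_left_mono power_decreasing mult_le_mono2) auto
    finally have "\<kappa> / c ^ (D * (S + N)) \<le> l * \<rho> ^ (?Q * N ^ 2)" .
    moreover have "c ^ (D * (S + N)) = c ^ (D * (m' + N)) * \<theta> ^ (N * ?Q)"
    proof -
      have "D * (S + N) = D * (m' + N) + D * (s + K) * (N * ?Q)"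
        by (simp add: S_def algebra_simps)
      then show ?thesis by (simp only: \<theta>_def power_add power_mult)
    qed
    ultimately have "\<kappa> / c ^ (D * (m' + N)) \<le> l * (\<rho> ^ (?Q * N ^ 2) * \<theta> ^ (N * ?Q))"
      using \<theta> c by (simp add: field_simps)
    also have "\<rho> ^ (?Q * N ^ 2) * \<theta> ^ (N * ?Q) = (\<rho> ^ N * \<theta>) ^ (N * ?Q)"
      by (simp add: power_mult_distrib power2_eq_square ac_simps flip: power_mult)
    also have "l * \<dots> \<le> l * (1 / 2) ^ (N * ?Q)"
      using l \<rho> \<theta> N by (intro mult_left_mono power_mono) auto
    \<comment> \<open>Only decay to 0 matters from here on, so the exponent is weakened to
      \<open>n\<close>.\<close>
    also have "\<dots> \<le> l * (1 / 2) ^ n"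
    proof -
      have "n \<le> N * ?Q" using q_power_gt[of n] N(2) by (metis le_trans less_imp_le mult_le_mono1 nat_mult_1)
      then show ?thesis using l by (intro mult_left_mono power_decreasing) auto
    qed
    finally show ?thesis .
  qed
  \<comment> \<open>The left side of \<open>main\<close> is a positive constant independent of
    \<open>n\<close>, while the right side tends to 0.\<close>
  define \<epsilon> where "\<epsilon> = \<kappa> / c ^ (D * (m' + N))"
  have "\<epsilon> > 0" using liouville(1) c by (simp add: \<epsilon>_def)
  then obtain n2 where n2: "(1 / 2) ^ n2 < \<epsilon> / l"
    using real_arch_pow_inv[of "\<epsilon> / l" "1 / 2"] l by auto
  define n where "n = max n2 (max n1 Q1)"
  have "(1 / 2) ^ n \<le> (1 / 2 :: real) ^ n2" by (intro power_decreasing) (auto simp: n_def)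
  then have "(1 / 2) ^ n < \<epsilon> / l" using n2 by linarith
  then have "l * (1 / 2) ^ n < \<epsilon>" using l by (simp add: field_simps)
  moreover have "\<epsilon> \<le> l * (1 / 2) ^ n" unfolding \<epsilon>_def by (rule main) (auto simp: n_def)
  ultimately show False by linarith
qed

end

section \<open>Application to the completed algebraic closure\<close>

lemma is_completion_subset: "is_completion v F L \<Longrightarrow> F \<subseteq> L"
  and is_algebraic_closure_subset: "is_algebraic_closure F A \<Longrightarrow> F \<subseteq> A"
  by (auto simp: is_completion_def is_algebraic_closure_def)

theorem theorem7:
  fixes p e q :: nat
    and j :: "'k::{field, finite} fls \<Rightarrow> 'c::field"
    and absC :: "'c \<Rightarrow> real"
    and C_alg :: "'c set"
    and c :: real
    and Kt Kt_alg KK :: "'c hahn set"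
    and f :: "'c hahn fps"
    and a b :: "'c hahn fls"
    and \<alpha> :: "'c hahn"
  assumes "prime p" and "q = p ^ e" and "CARD('k) = q"
    and "absolute_value absC"
    and "field_embedding j" and "\<And>s. absC (j s) = fls_abs q s"
    and "is_algebraic_closure (range j) C_alg"
    and "is_completion absC C_alg UNIV"
    and "c > 1"
    and "is_completion (hahn_abs c) C_t Kt"
    and "is_algebraic_closure Kt Kt_alg"
    and "is_completion (hahn_abs c) Kt_alg KK"
    and "\<And>i. fps_nth f i \<in> C_t"
    and "\<And>x. x \<in> KK \<Longrightarrow> hahn_abs c x < 1 \<Longrightarrow> \<exists>s. fps_sums_to (hahn_abs c) KK f x s"
    and "\<alpha> \<in> C_t" and "0 < hahn_abs c \<alpha>" and "hahn_abs c \<alpha> < 1"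
    and "transcendental_over C_t_x (fps_to_fls f)"
    and "a \<in> C_t_x" and "b \<in> C_t_x"
    and "fps_to_fls (tau_fps q f) = a * fps_to_fls f + b"
  shows "\<forall>\<^sub>F n in sequentially.
    \<exists>s. fps_sums_to (hahn_abs c) KK ((tau_fps q ^^ n) f) \<alpha> s \<and> transcendental_over C_t s"
proof -
  note c = \<open>c > 1\<close>
  have C_t_KK: "C_t \<subseteq> KK"
    using is_completion_subset[OF assms(10)] is_algebraic_closure_subset[OF assms(11)]
      is_completion_subset[OF assms(12)] by blast
  have KK: "is_subfield KK" "Metric_space.mcomplete KK (\<lambda>x y. hahn_abs c (x - y))"
    using assms(12) by (auto simp: is_completion_def)
  \<comment> \<open>A field has two distinct elements 0 and 1, which excludes
    \<open>e = 0\<close>.\<close>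
  have "card {0, 1 :: 'k} \<le> CARD('k)" by (intro card_mono) auto
  then have q2: "q \<ge> 2" using assms(3) by simp
  obtain s u v where uv: "u \<in> tpoly s" "v \<in> tpoly s" "v \<noteq> 0" "\<alpha> = u / v"
    using assms(15) unfolding C_t_iff by blast
  interpret mahler_setup c p q e \<alpha> u v s
    using assms uv q2 CHAR_embedded[OF assms(1) _ assms(5), of e]
    by unfold_locales auto
  have bounded: "bounded_coeffs c (hahn_abs c \<alpha>) f"
    using assms(14)[of \<alpha>] assms(15,17) C_t_KK sums_to_imp_bounded[OF c \<alpha>] by blast
  \<comment> \<open>For \<open>n \<ge> 1\<close> the exponent \<open>q ^ n\<close> is at least 2,
    which yields the enlarged radius of convergence.\<close>
  have "\<exists>s. fps_sums_to (hahn_abs c) KK (tau_fps (q ^ n) f) \<alpha> s \<and> has_value c \<alpha> (tau_fps (q ^ n) f) s"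
    if "n \<ge> 1" for n
  proof (rule bounded_imp_sums_to[OF c \<alpha> KK])
    show "fps_nth (tau_fps (q ^ n) f) i \<in> KK" for i
      using C_t_KK tau_C_t[OF assms(13)] KK(1) by (auto simp: tau_fps_def is_subfieldD)
    show "\<alpha> \<in> KK" using assms(15) C_t_KK by blast
    have "2 \<le> q ^ n" using power_increasing[OF that, of q] q2 by simp
    then show "bounded_coeffs c (sqrt (hahn_abs c \<alpha>)) (tau_fps (q ^ n) f)"
      by (rule bounded_coeffs_tau[OF c \<alpha> bounded])
  qed
  then obtain \<beta> where \<beta>: "\<And>n. n \<ge> 1 \<Longrightarrow> fps_sums_to (hahn_abs c) KK (tau_fps (q ^ n) f) \<alpha> (\<beta> n)"
    "\<And>n. n \<ge> 1 \<Longrightarrow> has_value c \<alpha> (tau_fps (q ^ n) f) (\<beta> n)" by metis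
  obtain B A m A' where AB: "B \<noteq> 0" "\<And>i. coeff A i \<in> tpoly m" "\<And>i. coeff A' i \<in> tpoly m"
    "\<And>i. coeff B i \<in> tpoly m" "fps_of_poly B * tau_fps q f = fps_of_poly A * f + fps_of_poly A'"
    by (rule functional_equation_clear_denominators[OF assms(19-21)]) blast
  have "\<forall>\<^sub>F n in sequentially. transcendental_over C_t (\<beta> n)"
    using values_eventually_transcendental[OF assms(13) bounded assms(18) AB(5,2,3,4,1) \<beta>(2)] .
  then show ?thesis using eventually_ge_at_top[of 1]
  proof eventually_elim
    case (elim n)
    moreover have "(tau_fps q ^^ n) f = tau_fps (q ^ n) f" using q2 by (intro tau_fps_funpow) simp
    ultimately show ?case using \<beta>(1)[of n] by auto
  qed
qed

end
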